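(* Let $R$ be an associative ring with identity, $n\geq 1$, and let $R\ltimes_n M_1\ltimes\cdots\ltimes M_n$ be the $n$-trivial extension of $R$ by a family $M=(M_i)_{i=1}^n$ of $R$-bimodules (with respect to an associative family $\Phi$ of products $\Phi_{i,j}:M_i\otimes_R M_j\to M_{i+j}$). Then the right $n$-trivial extension ${}_R\mathrm{Mod}\ltimes_n (M_i\otimes_R -)_{i}$ of the category of left $R$-modules is isomorphic to the category of left modules over the ring $R\ltimes_n M_1\ltimes\cdots\ltimes M_n$.
   Context: $n$-trivial extension ring: $M_1,\dots,M_n$ are $R$-bimodules and for all $i,j\geq 1$ with $i+j\leq n$ one is given an $R$-bimodule homomorphism $\Phi_{i,j}:M_i\otimes_R M_j\to M_{i+j}$, written $m_im_j:=\Phi_{i,j}(m_i\otimes m_j)$, such that $(m_im_j)m_k=m_i(m_jm_k)$ whenever $i+j+k\leq n$. The ring $R\ltimes_n M=R\ltimes_n M_1\ltimes\cdots\ltimes M_n$ is the additive group $R\oplus M_1\oplus\cdots\oplus M_n$ with multiplication $(m_0,\dots,m_n)(m'_0,\dots,m'_n)=\big(\sum_{i+j=k}m_im'_j\big)_{0\leq k\leq n}$ (with $M_0=R$ acting through the bimodule structures). The category ${}_R\mathrm{Mod}\ltimes_n (M_i\otimes_R -)_i$: put $I=\{1,\dots,n\}$, $F_i=M_i\otimes_R-$ and use the natural transformations $\Phi_{i,j}\otimes_R X:F_iF_jX=M_i\otimes_R M_j\otimes_R X\to M_{i+j}\otimes_R X=F_{i+j}X$ for $i+j\le n$. Objects are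 pairs $(X,f)$ with $X$ a left $R$-module and $f=(f_i)_{i\in I}$ a family of $R$-homomorphisms $f_i:F_iX\to X$ such that for all $i,j\in I$: $f_i\circ F_i(f_j)=f_{i+j}\circ(\Phi_{i,j}\otimes_R X)$ if $i+j\leq n$, and $f_i\circ F_i(f_j)=0$ if $i+j>n$. A morphism $(X,\alpha)\to(Y,\beta)$ is an $R$-homomorphism $\gamma:X\to Y$ with $\gamma\circ\alpha_i=\beta_i\circ F_i(\gamma)$ for all $i\in I$. *)

theory Defs
  imports "HOL-Algebra.Module" "HOL-Algebra.Free_Abelian_Groups"
begin

section \<open>Modules and bimodules over a non-commutative ring\<close>

text \<open>
  The locale \<^locale>\<open>module\<close> of HOL-Algebra assumes a commutative base ring.  We keep its
  record type (whose fields for a multiplication and a unit of the module play no role) and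
  drop commutativity.
\<close>

locale left_module = R?: ring R + M?: abelian_group M
  for R :: "('r, 's) ring_scheme" (structure)
    and M :: "('r, 'm, 't) module_scheme" (structure) +
  assumes smult_closed:
      "\<lbrakk>a \<in> carrier R; x \<in> carrier M\<rbrakk> \<Longrightarrow> a \<odot>\<^bsub>M\<^esub> x \<in> carrier M"
    and smult_l_distr:
      "\<lbrakk>a \<in> carrier R; b \<in> carrier R; x \<in> carrier M\<rbrakk> \<Longrightarrow>
        (a \<oplus> b) \<odot>\<^bsub>M\<^esub> x = a \<odot>\<^bsub>M\<^esub> x \<oplus>\<^bsub>M\<^esub> b \<odot>\<^bsub>M\<^esub> x"
    and smult_r_distr:
      "\<lbrakk>a \<in> carrier R; x \<in> carrier M; y \<in> carrier M\<rbrakk> \<Longrightarrow>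
        a \<odot>\<^bsub>M\<^esub> (x \<oplus>\<^bsub>M\<^esub> y) = a \<odot>\<^bsub>M\<^esub> x \<oplus>\<^bsub>M\<^esub> a \<odot>\<^bsub>M\<^esub> y"
    and smult_assoc1:
      "\<lbrakk>a \<in> carrier R; b \<in> carrier R; x \<in> carrier M\<rbrakk> \<Longrightarrow>
        (a \<otimes> b) \<odot>\<^bsub>M\<^esub> x = a \<odot>\<^bsub>M\<^esub> (b \<odot>\<^bsub>M\<^esub> x)"
    and smult_one:
      "x \<in> carrier M \<Longrightarrow> \<one> \<odot>\<^bsub>M\<^esub> x = x"

record ('r, 'm) bimodule = "('r, 'm) module" +
  rsmult :: "'m \<Rightarrow> 'r \<Rightarrow> 'm" (infixl \<open>\<star>\<index>\<close> 70)

locale bimodule = left_module R M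
  for R :: "('r, 's) ring_scheme" (structure)
    and M :: "('r, 'm, 't) bimodule_scheme" (structure) +
  assumes rsmult_closed:
      "\<lbrakk>x \<in> carrier M; a \<in> carrier R\<rbrakk> \<Longrightarrow> x \<star>\<^bsub>M\<^esub> a \<in> carrier M"
    and rsmult_l_distr:
      "\<lbrakk>x \<in> carrier M; y \<in> carrier M; a \<in> carrier R\<rbrakk> \<Longrightarrow>
        (x \<oplus>\<^bsub>M\<^esub> y) \<star>\<^bsub>M\<^esub> a = x \<star>\<^bsub>M\<^esub> a \<oplus>\<^bsub>M\<^esub> y \<star>\<^bsub>M\<^esub> a"
    and rsmult_r_distr:
      "\<lbrakk>x \<in> carrier M; a \<in> carrier R; b \<in> carrier R\<rbrakk> \<Longrightarrow>
        x \<star>\<^bsub>M\<^esub> (a \<oplus> b) = x \<star>\<^bsub>M\<^esub> a \<oplus>\<^bsub>M\<^esub> x \<star>\<^bsub>M\<^esub> b"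
    and rsmult_assoc:
      "\<lbrakk>x \<in> carrier M; a \<in> carrier R; b \<in> carrier R\<rbrakk> \<Longrightarrow>
        x \<star>\<^bsub>M\<^esub> (a \<otimes> b) = (x \<star>\<^bsub>M\<^esub> a) \<star>\<^bsub>M\<^esub> b"
    and rsmult_one:
      "x \<in> carrier M \<Longrightarrow> x \<star>\<^bsub>M\<^esub> \<one> = x"
    and smult_rsmult:
      "\<lbrakk>a \<in> carrier R; x \<in> carrier M; b \<in> carrier R\<rbrakk> \<Longrightarrow>
        (a \<odot>\<^bsub>M\<^esub> x) \<star>\<^bsub>M\<^esub> b = a \<odot>\<^bsub>M\<^esub> (x \<star>\<^bsub>M\<^esub> b)"

definition left_module_hom ::
  "('r, 's) ring_scheme \<Rightarrow> ('r, 'x, 't) module_scheme \<Rightarrow> ('r, 'y, 'u) module_scheme \<Rightarrow> ('x \<Rightarrow> 'y) set"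
  where "left_module_hom R X Y =
    {h \<in> carrier X \<rightarrow> carrier Y.
       (\<forall>x\<in>carrier X. \<forall>y\<in>carrier X. h (x \<oplus>\<^bsub>X\<^esub> y) = h x \<oplus>\<^bsub>Y\<^esub> h y) \<and>
       (\<forall>r\<in>carrier R. \<forall>x\<in>carrier X. h (r \<odot>\<^bsub>X\<^esub> x) = r \<odot>\<^bsub>Y\<^esub> h x)}"

definition bimodule_hom ::
  "('r, 's) ring_scheme \<Rightarrow> ('r, 'x, 't) bimodule_scheme \<Rightarrow> ('r, 'y, 'u) bimodule_scheme \<Rightarrow> ('x \<Rightarrow> 'y) set"
  where "bimodule_hom R X Y =
    {h \<in> left_module_hom R X Y.
       \<forall>r\<in>carrier R. \<forall>x\<in>carrier X. h (x \<star>\<^bsub>X\<^esub> r) = h x \<star>\<^bsub>Y\<^esub> r}"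


section \<open>Tensor products over a non-commutative ring\<close>

text \<open>
  For a bimodule \<open>A\<close> and a left module \<open>B\<close>, the abelian group \<open>A \<otimes>\<^sub>R B\<close> is the free abelian
  group on the set of pairs modulo the usual relations.  Its elements are cosets, hence the
  following type.
\<close>

type_synonym ('a, 'b) tens = "('a \<times> 'b \<Rightarrow>\<^sub>0 int) set"

definition tensor_rels ::
  "('r, 's) ring_scheme \<Rightarrow> ('r, 'a, 't) bimodule_scheme \<Rightarrow> ('r, 'b, 'u) module_scheme \<Rightarrow> ('a \<times> 'b \<Rightarrow>\<^sub>0 int) set"
  where "tensor_rels R A B =
    {frag_of (a \<oplus>\<^bsub>A\<^esub> a', b) - frag_of (a, b) - frag_of (a', b) | a a' b.
       a \<in> carrier A \<and> a' \<in> carrier A \<and> b \<in> carrier B} \<union>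
    {frag_of (a, b \<oplus>\<^bsub>B\<^esub> b') - frag_of (a, b) - frag_of (a, b') | a b b'.
       a \<in> carrier A \<and> b \<in> carrier B \<and> b' \<in> carrier B} \<union>
    {frag_of (a \<star>\<^bsub>A\<^esub> r, b) - frag_of (a, r \<odot>\<^bsub>B\<^esub> b) | a r b.
       a \<in> carrier A \<and> r \<in> carrier R \<and> b \<in> carrier B}"

definition tensor_ker ::
  "('r, 's) ring_scheme \<Rightarrow> ('r, 'a, 't) bimodule_scheme \<Rightarrow> ('r, 'b, 'u) module_scheme \<Rightarrow> ('a \<times> 'b \<Rightarrow>\<^sub>0 int) set"
  where "tensor_ker R A B =
    generate (free_Abelian_group (carrier A \<times> carrier B)) (tensor_rels R A B)"

definition tensor_group ::
  "('r, 's) ring_scheme \<Rightarrow> ('r, 'a, 't) bimodule_scheme \<Rightarrow> ('r, 'b, 'u) module_scheme \<Rightarrow> ('a, 'b) tens monoid"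
  where "tensor_group R A B =
    free_Abelian_group (carrier A \<times> carrier B) Mod tensor_ker R A B"

definition tensor_elt ::
  "('r, 's) ring_scheme \<Rightarrow> ('r, 'a, 't) bimodule_scheme \<Rightarrow> ('r, 'b, 'u) module_scheme \<Rightarrow> 'a \<Rightarrow> 'b \<Rightarrow> ('a, 'b) tens"
  where "tensor_elt R A B a b =
    tensor_ker R A B #>\<^bsub>free_Abelian_group (carrier A \<times> carrier B)\<^esub> frag_of (a, b)"

text \<open>
  The homomorphism from the tensor product to an abelian group \<open>H\<close> induced by a balanced
  biadditive map \<open>\<beta>\<close>, i.e. the one sending each \<open>a \<otimes> b\<close> to \<open>\<beta> a b\<close>.
\<close>

definition tensor_lift ::
  "('r, 's) ring_scheme \<Rightarrow> ('r, 'a, 't) bimodule_scheme \<Rightarrow> ('r, 'b, 'u) module_scheme \<Rightarrow>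
     ('h, 'v) monoid_scheme \<Rightarrow> ('a \<Rightarrow> 'b \<Rightarrow> 'h) \<Rightarrow> ('a, 'b) tens \<Rightarrow> 'h"
  where "tensor_lift R A B H \<beta> =
    (THE h. h \<in> extensional (carrier (tensor_group R A B)) \<and>
            h \<in> hom (tensor_group R A B) H \<and>
            (\<forall>a\<in>carrier A. \<forall>b\<in>carrier B. h (tensor_elt R A B a b) = \<beta> a b))"

definition tensor ::
  "('r, 's) ring_scheme \<Rightarrow> ('r, 'a, 't) bimodule_scheme \<Rightarrow> ('r, 'b, 'u) module_scheme \<Rightarrow> ('r, ('a, 'b) tens) module"
  where "tensor R A B =
    \<lparr>carrier = carrier (tensor_group R A B),
     monoid.mult = undefined,
     monoid.one = undefined,
     ring.zero = \<one>\<^bsub>tensor_group R A B\<^esub>,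
     ring.add = (\<lambda>s t. s \<otimes>\<^bsub>tensor_group R A B\<^esub> t),
     smult = (\<lambda>r. tensor_lift R A B (tensor_group R A B) (\<lambda>a b. tensor_elt R A B (r \<odot>\<^bsub>A\<^esub> a) b))\<rparr>"

definition bimodule_tensor ::
  "('r, 's) ring_scheme \<Rightarrow> ('r, 'a, 't) bimodule_scheme \<Rightarrow> ('r, 'b, 'u) bimodule_scheme \<Rightarrow> ('r, ('a, 'b) tens) bimodule"
  where "bimodule_tensor R A B =
    module.extend (tensor R A B)
      \<lparr>rsmult = (\<lambda>t r. tensor_lift R A B (tensor_group R A B) (\<lambda>a b. tensor_elt R A B a (b \<star>\<^bsub>B\<^esub> r)) t)\<rparr>"

text \<open>\<open>f \<otimes> g : A \<otimes>\<^sub>R B \<rightarrow> A' \<otimes>\<^sub>R B'\<close>\<close>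

definition tensor_map ::
  "('r, 's) ring_scheme \<Rightarrow>
     ('r, 'a, 't) bimodule_scheme \<Rightarrow> ('r, 'b, 'u) module_scheme \<Rightarrow>
     ('r, 'c, 'v) bimodule_scheme \<Rightarrow> ('r, 'd, 'w) module_scheme \<Rightarrow>
     ('a \<Rightarrow> 'c) \<Rightarrow> ('b \<Rightarrow> 'd) \<Rightarrow> ('a, 'b) tens \<Rightarrow> ('c, 'd) tens"
  where "tensor_map R A B A' B' f g =
    tensor_lift R A B (tensor_group R A' B') (\<lambda>a b. tensor_elt R A' B' (f a) (g b))"

text \<open>The canonical map \<open>A \<otimes>\<^sub>R (B \<otimes>\<^sub>R X) \<rightarrow> (A \<otimes>\<^sub>R B) \<otimes>\<^sub>R X\<close>, \<open>a \<otimes> (b \<otimes> x) \<mapsto> (a \<otimes> b) \<otimes> x\<close>\<close>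

definition tensor_assoc ::
  "('r, 's) ring_scheme \<Rightarrow> ('r, 'a, 't) bimodule_scheme \<Rightarrow> ('r, 'b, 'u) bimodule_scheme \<Rightarrow>
     ('r, 'x, 'v) module_scheme \<Rightarrow> ('a, ('b, 'x) tens) tens \<Rightarrow> (('a, 'b) tens, 'x) tens"
  where "tensor_assoc R A B X =
    tensor_lift R A (tensor R B X) (tensor_group R (bimodule_tensor R A B) X)
      (\<lambda>a. tensor_lift R B X (tensor_group R (bimodule_tensor R A B) X)
        (\<lambda>b x. tensor_elt R (bimodule_tensor R A B) X (tensor_elt R A B a b) x))"


section \<open>Categories\<close>

text \<open>
  Arrows are only meaningful relative to their source and target: the sets \<open>Hom X Y\<close> need not
  be disjoint, and composition takes the three objects involved as arguments.
\<close>

record ('o, 'a) category =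
  Obj :: "'o set"
  Hom :: "'o \<Rightarrow> 'o \<Rightarrow> 'a set"
  Ident :: "'o \<Rightarrow> 'a"
  Comp :: "'o \<Rightarrow> 'o \<Rightarrow> 'o \<Rightarrow> 'a \<Rightarrow> 'a \<Rightarrow> 'a"

locale category =
  fixes C :: "('o, 'a) category"
  assumes Ident_Hom: "X \<in> Obj C \<Longrightarrow> Ident C X \<in> Hom C X X"
    and Comp_Hom:
      "\<lbrakk>X \<in> Obj C; Y \<in> Obj C; Z \<in> Obj C; f \<in> Hom C X Y; g \<in> Hom C Y Z\<rbrakk> \<Longrightarrow>
        Comp C X Y Z g f \<in> Hom C X Z"
    and Comp_Ident_right:
      "\<lbrakk>X \<in> Obj C; Y \<in> Obj C; f \<in> Hom C X Y\<rbrakk> \<Longrightarrow> Comp C X X Y f (Ident C X) = f"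
    and Comp_Ident_left:
      "\<lbrakk>X \<in> Obj C; Y \<in> Obj C; f \<in> Hom C X Y\<rbrakk> \<Longrightarrow> Comp C X Y Y (Ident C Y) f = f"
    and Comp_assoc:
      "\<lbrakk>W \<in> Obj C; X \<in> Obj C; Y \<in> Obj C; Z \<in> Obj C;
        f \<in> Hom C W X; g \<in> Hom C X Y; h \<in> Hom C Y Z\<rbrakk> \<Longrightarrow>
        Comp C W X Z (Comp C X Y Z h g) f = Comp C W Y Z h (Comp C W X Y g f)"

locale category_functor = C: category C + D: category D
  for C :: "('o, 'a) category" and D :: "('p, 'b) category" +
  fixes Fo :: "'o \<Rightarrow> 'p" and Fa :: "'o \<Rightarrow> 'o \<Rightarrow> 'a \<Rightarrow> 'b"
  assumes Fo_Obj: "X \<in> Obj C \<Longrightarrow> Fo X \<in> Obj D"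
    and Fa_Hom:
      "\<lbrakk>X \<in> Obj C; Y \<in> Obj C; f \<in> Hom C X Y\<rbrakk> \<Longrightarrow> Fa X Y f \<in> Hom D (Fo X) (Fo Y)"
    and Fa_Ident: "X \<in> Obj C \<Longrightarrow> Fa X X (Ident C X) = Ident D (Fo X)"
    and Fa_Comp:
      "\<lbrakk>X \<in> Obj C; Y \<in> Obj C; Z \<in> Obj C; f \<in> Hom C X Y; g \<in> Hom C Y Z\<rbrakk> \<Longrightarrow>
        Fa X Z (Comp C X Y Z g f) = Comp D (Fo X) (Fo Y) (Fo Z) (Fa Y Z g) (Fa X Y f)"

definition isomorphic_categories :: "('o, 'a) category \<Rightarrow> ('p, 'b) category \<Rightarrow> bool"
  where "isomorphic_categories C D \<longleftrightarrow>
    (\<exists>Fo Fa Go Ga.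
       category_functor C D Fo Fa \<and> category_functor D C Go Ga \<and>
       (\<forall>X\<in>Obj C. Go (Fo X) = X) \<and>
       (\<forall>X\<in>Obj C. \<forall>Y\<in>Obj C. \<forall>f\<in>Hom C X Y. Ga (Fo X) (Fo Y) (Fa X Y f) = f) \<and>
       (\<forall>X\<in>Obj D. Fo (Go X) = X) \<and>
       (\<forall>X\<in>Obj D. \<forall>Y\<in>Obj D. \<forall>f\<in>Hom D X Y. Fa (Go X) (Go Y) (Ga X Y f) = f))"


section \<open>The category of left modules\<close>

text \<open>
  A module record also fixes the values of its operations outside the carrier, and it has two
  fields unused by modules.  So that equality of records is equality of modules, the objects of
  the category have all this irrelevant information set to \<^const>\<open>undefined\<close>; likewise,
  arrows are extensional functions.
\<close>

definition normalized_module :: "('r, 's) ring_scheme \<Rightarrow> ('r, 'x) module \<Rightarrow> bool"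
  where "normalized_module R X \<longleftrightarrow>
    monoid.mult X = undefined \<and> monoid.one X = undefined \<and>
    (\<forall>x y. x \<notin> carrier X \<or> y \<notin> carrier X \<longrightarrow> x \<oplus>\<^bsub>X\<^esub> y = undefined) \<and>
    (\<forall>r x. r \<notin> carrier R \<or> x \<notin> carrier X \<longrightarrow> r \<odot>\<^bsub>X\<^esub> x = undefined)"

definition left_modules :: "('r, 's) ring_scheme \<Rightarrow> ('r, 'x) module set"
  where "left_modules R = {X. left_module R X \<and> normalized_module R X}"

definition left_module_category ::
  "('r, 's) ring_scheme \<Rightarrow> (('r, 'x) module, 'x \<Rightarrow> 'x) category"
  where "left_module_category R =
    \<lparr>Obj = left_modules R,
     Hom = (\<lambda>X Y. left_module_hom R X Y \<inter> extensional (carrier X)),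
     Ident = (\<lambda>X. \<lambda>x\<in>carrier X. x),
     Comp = (\<lambda>X Y Z g f. compose (carrier X) g f)\<rparr>"


section \<open>Trivial extensions\<close>

text \<open>
  \<open>\<Phi> i j\<close> is the product \<open>M\<^sub>i \<otimes>\<^sub>R M\<^sub>j \<rightarrow> M\<^sub>i\<^sub>+\<^sub>j\<close>; only the indices with \<open>i, j \<ge> 1\<close> and
  \<open>i + j \<le> n\<close> matter.
\<close>

definition phi_prod ::
  "('r, 's) ring_scheme \<Rightarrow> (nat \<Rightarrow> ('r, 'm) bimodule) \<Rightarrow>
     (nat \<Rightarrow> nat \<Rightarrow> ('m, 'm) tens \<Rightarrow> 'm) \<Rightarrow> nat \<Rightarrow> nat \<Rightarrow> 'm \<Rightarrow> 'm \<Rightarrow> 'm"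
  where "phi_prod R M \<Phi> i j x y = \<Phi> i j (tensor_elt R (M i) (M j) x y)"

definition associative_products ::
  "nat \<Rightarrow> ('r, 's) ring_scheme \<Rightarrow> (nat \<Rightarrow> ('r, 'm) bimodule) \<Rightarrow>
     (nat \<Rightarrow> nat \<Rightarrow> ('m, 'm) tens \<Rightarrow> 'm) \<Rightarrow> bool"
  where "associative_products n R M \<Phi> \<longleftrightarrow>
    (\<forall>i j. 1 \<le> i \<and> 1 \<le> j \<and> i + j \<le> n \<longrightarrow>
       \<Phi> i j \<in> bimodule_hom R (bimodule_tensor R (M i) (M j)) (M (i + j))) \<and>
    (\<forall>i j k. 1 \<le> i \<and> 1 \<le> j \<and> 1 \<le> k \<and> i + j + k \<le> n \<longrightarrow>
       (\<forall>x\<in>carrier (M i). \<forall>y\<in>carrier (M j). \<forall>z\<in>carrier (M k).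
          phi_prod R M \<Phi> (i + j) k (phi_prod R M \<Phi> i j x y) z =
          phi_prod R M \<Phi> i (j + k) x (phi_prod R M \<Phi> j k y z)))"

text \<open>
  An element \<open>(m\<^sub>0, m\<^sub>1, \<dots>, m\<^sub>n)\<close> of the \<open>n\<close>-trivial extension ring is encoded as the pair of
  \<open>m\<^sub>0 \<in> R\<close> and the extensional family \<open>(m\<^sub>i)\<close> on \<open>{1..n}\<close>.  In degree \<open>k \<ge> 1\<close> the sum over
  \<open>i + j = k\<close> is split into the terms \<open>i = 0\<close>, \<open>1 \<le> i < k\<close> and \<open>i = k\<close>.
\<close>

definition trivial_extension_ring ::
  "nat \<Rightarrow> ('r, 's) ring_scheme \<Rightarrow> (nat \<Rightarrow> ('r, 'm) bimodule) \<Rightarrow>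
     (nat \<Rightarrow> nat \<Rightarrow> ('m, 'm) tens \<Rightarrow> 'm) \<Rightarrow> ('r \<times> (nat \<Rightarrow> 'm)) ring"
  where "trivial_extension_ring n R M \<Phi> =
    \<lparr>carrier = carrier R \<times> (\<Pi>\<^sub>E i\<in>{1..n}. carrier (M i)),
     monoid.mult = (\<lambda>(r, m) (r', m').
       (r \<otimes>\<^bsub>R\<^esub> r',
        \<lambda>k\<in>{1..n}.
          r \<odot>\<^bsub>M k\<^esub> m' k
          \<oplus>\<^bsub>M k\<^esub> finsum (M k) (\<lambda>i. phi_prod R M \<Phi> i (k - i) (m i) (m' (k - i))) {1..<k}
          \<oplus>\<^bsub>M k\<^esub> m k \<star>\<^bsub>M k\<^esub> r')),
     monoid.one = (\<one>\<^bsub>R\<^esub>, \<lambda>k\<in>{1..n}. \<zero>\<^bsub>M k\<^esub>),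
     ring.zero = (\<zero>\<^bsub>R\<^esub>, \<lambda>k\<in>{1..n}. \<zero>\<^bsub>M k\<^esub>),
     ring.add = (\<lambda>(r, m) (r', m'). (r \<oplus>\<^bsub>R\<^esub> r', \<lambda>k\<in>{1..n}. m k \<oplus>\<^bsub>M k\<^esub> m' k))\<rparr>"

text \<open>
  The component at \<open>X\<close> of the natural transformation \<open>\<Phi>\<^bsub>i,j\<^esub> \<otimes>\<^sub>R X : M\<^sub>i \<otimes>\<^sub>R (M\<^sub>j \<otimes>\<^sub>R X) \<rightarrow> M\<^bsub>i+j\<^esub> \<otimes>\<^sub>R X\<close>
\<close>

definition phi_tensor ::
  "('r, 's) ring_scheme \<Rightarrow> (nat \<Rightarrow> ('r, 'm) bimodule) \<Rightarrow>
     (nat \<Rightarrow> nat \<Rightarrow> ('m, 'm) tens \<Rightarrow> 'm) \<Rightarrow> nat \<Rightarrow> nat \<Rightarrow> ('r, 'x) module \<Rightarrow>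
     ('m, ('m, 'x) tens) tens \<Rightarrow> ('m, 'x) tens"
  where "phi_tensor R M \<Phi> i j X t =
    tensor_map R (bimodule_tensor R (M i) (M j)) X (M (i + j)) X (\<Phi> i j) id
      (tensor_assoc R (M i) (M j) X t)"

text \<open>Morphism part of the functor \<open>F\<^sub>i = M\<^sub>i \<otimes>\<^sub>R -\<close>\<close>

definition F_map ::
  "('r, 's) ring_scheme \<Rightarrow> (nat \<Rightarrow> ('r, 'm) bimodule) \<Rightarrow> nat \<Rightarrow>
     ('r, 'x) module \<Rightarrow> ('r, 'y) module \<Rightarrow> ('x \<Rightarrow> 'y) \<Rightarrow> ('m, 'x) tens \<Rightarrow> ('m, 'y) tens"
  where "F_map R M i X Y g = tensor_map R (M i) X (M i) Y id g"

definition trivial_extension_objects ::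
  "nat \<Rightarrow> ('r, 's) ring_scheme \<Rightarrow> (nat \<Rightarrow> ('r, 'm) bimodule) \<Rightarrow>
     (nat \<Rightarrow> nat \<Rightarrow> ('m, 'm) tens \<Rightarrow> 'm) \<Rightarrow>
     (('r, 'x) module \<times> (nat \<Rightarrow> ('m, 'x) tens \<Rightarrow> 'x)) set"
  where "trivial_extension_objects n R M \<Phi> =
    {(X, f). X \<in> left_modules R \<and>
       f \<in> (\<Pi>\<^sub>E i\<in>{1..n}. left_module_hom R (tensor R (M i) X) X
                        \<inter> extensional (carrier (tensor R (M i) X))) \<and>
       (\<forall>i\<in>{1..n}. \<forall>j\<in>{1..n}. \<forall>t\<in>carrier (tensor R (M i) (tensor R (M j) X)).
          f i (F_map R M i (tensor R (M j) X) X (f j) t) =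
          (if i + j \<le> n then f (i + j) (phi_tensor R M \<Phi> i j X t) else \<zero>\<^bsub>X\<^esub>))}"

definition trivial_extension_category ::
  "nat \<Rightarrow> ('r, 's) ring_scheme \<Rightarrow> (nat \<Rightarrow> ('r, 'm) bimodule) \<Rightarrow>
     (nat \<Rightarrow> nat \<Rightarrow> ('m, 'm) tens \<Rightarrow> 'm) \<Rightarrow>
     (('r, 'x) module \<times> (nat \<Rightarrow> ('m, 'x) tens \<Rightarrow> 'x), 'x \<Rightarrow> 'x) category"
  where "trivial_extension_category n R M \<Phi> =
    \<lparr>Obj = trivial_extension_objects n R M \<Phi>,
     Hom = (\<lambda>(X, \<alpha>) (Y, \<beta>).
       {\<gamma> \<in> Hom (left_module_category R) X Y.
          \<forall>i\<in>{1..n}. \<forall>t\<in>carrier (tensor R (M i) X). \<gamma> (\<alpha> i t) = \<beta> i (F_map R M i X Y \<gamma> t)}),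
     Ident = (\<lambda>(X, \<alpha>). Ident (left_module_category R) X),
     Comp = (\<lambda>(X, \<alpha>) (Y, \<beta>) (Z, \<delta>). Comp (left_module_category R) X Y Z)\<rparr>"

end

theory Submission
  imports Defs
begin

text \<open>
  By the universal property of the tensor product, an object \<open>(X, f)\<close> is a left \<open>R\<close>-module
  with biadditive actions \<open>M\<^sub>i \<times> X \<rightarrow> X\<close>, \<open>m x = f\<^sub>i (m \<otimes> x)\<close>, which are linear
  over \<open>R\<close> and satisfy \<open>m (m' x) = (m m') x\<close>, read as \<open>0\<close> in degrees above \<open>n\<close>.  Such data
  are the same as an action \<open>(m\<^sub>0, \<dots>, m\<^sub>n) x = m\<^sub>0 x + \<dots> + m\<^sub>n x\<close> of the trivial
  extension on the abelian group \<open>X\<close>, since the ring is the direct sum of \<open>R\<close> and the \<open>M\<^sub>i\<close>.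
  The homomorphisms on both sides are the same maps.
\<close>

section \<open>Tensor products\<close>

text \<open>An isomorphism of categories is claimed, not an equivalence, so both round trips must be
  equalities of records. This works because objects and arrows are normalized: module operations are
  \<open>undefined\<close> off the carriers, and arrows and structure maps are extensional. Both
  functors keep the underlying functions of arrows, so the work lies in the objects.

  At the outset \<open>S\<close> is only a record, not known to be a ring. The one long computation,
  that the formula for the action of \<open>S\<close> on a module is compatible with products in
  \<open>S\<close>, is therefore done for an arbitrary graded action without any ring law of
  \<open>S\<close>. The module underlying \<open>S\<close> is itself an example of a graded action,
  and this example yields associativity and distributivity in \<open>S\<close>.

  Elements of tensor products are cosets and lifts are given by a description operator. All
  reasoning about them goes through two tools: induction over products of pure tensors, and the
  existence and uniqueness of lifts.\<close>

definition balanced ::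
  "('r, 's) ring_scheme \<Rightarrow> ('r, 'a, 't) bimodule_scheme \<Rightarrow> ('r, 'b, 'u) module_scheme \<Rightarrow>
     ('h, 'v) monoid_scheme \<Rightarrow> ('a \<Rightarrow> 'b \<Rightarrow> 'h) \<Rightarrow> bool"
  where "balanced R A B H \<beta> \<longleftrightarrow>
    (\<forall>a\<in>carrier A. \<forall>b\<in>carrier B. \<beta> a b \<in> carrier H) \<and>
    (\<forall>a\<in>carrier A. \<forall>a'\<in>carrier A. \<forall>b\<in>carrier B.
       \<beta> (a \<oplus>\<^bsub>A\<^esub> a') b = \<beta> a b \<otimes>\<^bsub>H\<^esub> \<beta> a' b) \<and>
    (\<forall>a\<in>carrier A. \<forall>b\<in>carrier B. \<forall>b'\<in>carrier B.
       \<beta> a (b \<oplus>\<^bsub>B\<^esub> b') = \<beta> a b \<otimes>\<^bsub>H\<^esub> \<beta> a b') \<and>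
    (\<forall>a\<in>carrier A. \<forall>r\<in>carrier R. \<forall>b\<in>carrier B.
       \<beta> (a \<star>\<^bsub>A\<^esub> r) b = \<beta> a (r \<odot>\<^bsub>B\<^esub> b))"

locale tensor_product = A: bimodule R A + B: left_module R B
  for R :: "('r, 's) ring_scheme" (structure)
    and A :: "('r, 'a, 't) bimodule_scheme"
    and B :: "('r, 'b, 'u) module_scheme"
begin

abbreviation F where "F \<equiv> free_Abelian_group (carrier A \<times> carrier B)"
abbreviation K where "K \<equiv> tensor_ker R A B"
abbreviation T where "T \<equiv> tensor_group R A B"
abbreviation elt where "elt \<equiv> tensor_elt R A B"

lemma tensor_rels_carrier: "tensor_rels R A B \<subseteq> carrier F"
proof
  fix x assume "x \<in> tensor_rels R A B"
  moreover have d: "u - v \<in> carrier F" if "u \<in> carrier F" "v \<in> carrier F" for u v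
    using that keys_diff[of u v] by auto
  ultimately show "x \<in> carrier F"
    unfolding tensor_rels_def
    by (auto intro!: d simp del: carrier_free_Abelian_group_iff
        simp: A.rsmult_closed B.smult_closed)
qed

sublocale F: comm_group F
  by (rule abelian_free_Abelian_group)

lemma tensor_ker_subgroup: "subgroup K F"
  unfolding tensor_ker_def by (rule F.generate_is_subgroup[OF tensor_rels_carrier])

sublocale K: normal K F
  by (rule F.subgroup_imp_normal[OF tensor_ker_subgroup])

lemma tensor_rels_ker: "x \<in> tensor_rels R A B \<Longrightarrow> x \<in> K"
  unfolding tensor_ker_def by (rule generate.incl)

lemma coset_eqI:
  assumes "u \<in> carrier F" "v \<in> carrier F" "u - v \<in> K"
  shows "K #>\<^bsub>F\<^esub> u = K #>\<^bsub>F\<^esub> v"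
proof -
  have "u \<otimes>\<^bsub>F\<^esub> inv\<^bsub>F\<^esub> v \<in> K" using assms by simp
  then have "u \<in> K #>\<^bsub>F\<^esub> v"
    using K.rcos_module_rev[OF F.is_group] assms by blast
  then show ?thesis
    using F.repr_independence assms(2) tensor_ker_subgroup by metis
qed

lemma coset_mult:
  assumes "u \<in> carrier F" "v \<in> carrier F"
  shows "(K #>\<^bsub>F\<^esub> u) \<otimes>\<^bsub>T\<^esub> (K #>\<^bsub>F\<^esub> v) = K #>\<^bsub>F\<^esub> (u + v)"
  using K.rcos_sum[OF assms] by (simp add: tensor_group_def FactGroup_def)

lemma coset_closed: "u \<in> carrier F \<Longrightarrow> K #>\<^bsub>F\<^esub> u \<in> carrier T"
  by (auto simp: tensor_group_def FactGroup_def RCOSETS_def)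

lemma coset_cases:
  assumes "t \<in> carrier T"
  obtains u where "u \<in> carrier F" "t = K #>\<^bsub>F\<^esub> u"
  using assms by (auto simp: tensor_group_def FactGroup_def RCOSETS_def)

sublocale T: comm_group T
proof (rule group.group_comm_groupI)
  show "group T" unfolding tensor_group_def by (rule K.factorgroup_is_group)
  fix x y assume "x \<in> carrier T" "y \<in> carrier T"
  then obtain u v where "u \<in> carrier F" "x = K #>\<^bsub>F\<^esub> u" "v \<in> carrier F" "y = K #>\<^bsub>F\<^esub> v"
    by (metis coset_cases)
  then show "x \<otimes>\<^bsub>T\<^esub> y = y \<otimes>\<^bsub>T\<^esub> x" by (simp only: coset_mult add.commute)
qed

lemma coset_hom: "(\<lambda>u. K #>\<^bsub>F\<^esub> u) \<in> hom F T"
  by (rule homI) (simp_all only: coset_closed coset_mult mult_free_Abelian_group)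

lemma frag_closed: "a \<in> carrier A \<Longrightarrow> b \<in> carrier B \<Longrightarrow> frag_of (a, b) \<in> carrier F"
  by simp

lemma elt_closed: "a \<in> carrier A \<Longrightarrow> b \<in> carrier B \<Longrightarrow> elt a b \<in> carrier T"
  unfolding tensor_elt_def by (intro coset_closed frag_closed)

lemma elt_add_left:
  assumes "a \<in> carrier A" "a' \<in> carrier A" "b \<in> carrier B"
  shows "elt (a \<oplus>\<^bsub>A\<^esub> a') b = elt a b \<otimes>\<^bsub>T\<^esub> elt a' b"
proof -
  have "frag_of (a \<oplus>\<^bsub>A\<^esub> a', b) - (frag_of (a, b) + frag_of (a', b)) \<in> K"
    by (rule tensor_rels_ker) (use assms in \<open>auto simp: tensor_rels_def diff_diff_eq\<close>)
  moreover have "frag_of (a, b) + frag_of (a', b) \<in> carrier F"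
    using F.m_closed[OF frag_closed frag_closed] assms by simp
  ultimately show ?thesis
    unfolding tensor_elt_def using assms
    by (subst coset_mult) (intro frag_closed coset_eqI | simp)+
qed

lemma elt_add_right:
  assumes "a \<in> carrier A" "b \<in> carrier B" "b' \<in> carrier B"
  shows "elt a (b \<oplus>\<^bsub>B\<^esub> b') = elt a b \<otimes>\<^bsub>T\<^esub> elt a b'"
proof -
  have "frag_of (a, b \<oplus>\<^bsub>B\<^esub> b') - (frag_of (a, b) + frag_of (a, b')) \<in> K"
    by (rule tensor_rels_ker) (use assms in \<open>auto simp: tensor_rels_def diff_diff_eq\<close>)
  moreover have "frag_of (a, b) + frag_of (a, b') \<in> carrier F"
    using F.m_closed[OF frag_closed frag_closed] assms by simp
  ultimately show ?thesis
    unfolding tensor_elt_def using assms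
    by (subst coset_mult) (intro frag_closed coset_eqI | simp)+
qed

lemma elt_balanced:
  assumes "a \<in> carrier A" "r \<in> carrier R" "b \<in> carrier B"
  shows "elt (a \<star>\<^bsub>A\<^esub> r) b = elt a (r \<odot>\<^bsub>B\<^esub> b)"
proof -
  have "frag_of (a \<star>\<^bsub>A\<^esub> r, b) - frag_of (a, r \<odot>\<^bsub>B\<^esub> b) \<in> K"
    by (rule tensor_rels_ker) (use assms in \<open>auto simp: tensor_rels_def\<close>)
  then show ?thesis
    unfolding tensor_elt_def
    by (intro coset_eqI frag_closed) (use assms in \<open>auto intro: A.rsmult_closed B.smult_closed\<close>)
qed

lemma elt_zero_left:
  assumes "b \<in> carrier B" shows "elt \<zero>\<^bsub>A\<^esub> b = \<one>\<^bsub>T\<^esub>"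
  using elt_add_left[of "\<zero>\<^bsub>A\<^esub>" "\<zero>\<^bsub>A\<^esub>" b] assms
  by (simp add: elt_closed T.r_cancel_one')

text \<open>Additivity in the left factor makes the inverse of a pure tensor again a pure tensor.
  This is why the induction principle below has no case for inverses.\<close>

lemma inv_elt:
  assumes "a \<in> carrier A" "b \<in> carrier B"
  shows "inv\<^bsub>T\<^esub> (elt a b) = elt (\<ominus>\<^bsub>A\<^esub> a) b"
proof (rule T.inv_equality)
  show "elt (\<ominus>\<^bsub>A\<^esub> a) b \<otimes>\<^bsub>T\<^esub> elt a b = \<one>\<^bsub>T\<^esub>"
    using assms elt_add_left[of "\<ominus>\<^bsub>A\<^esub> a" a b] by (simp add: A.M.l_neg elt_zero_left)
qed (use assms in \<open>simp_all add: elt_closed\<close>)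

text \<open>Pure tensors generate the group under multiplication alone: the unit is the tensor of
  two zeros, and inverses of pure tensors are pure.\<close>

lemma tensor_induct [consumes 1, case_names elt mult]:
  assumes "t \<in> carrier T"
    and elt: "\<And>a b. a \<in> carrier A \<Longrightarrow> b \<in> carrier B \<Longrightarrow> P (elt a b)"
    and mult: "\<And>s t. s \<in> carrier T \<Longrightarrow> t \<in> carrier T \<Longrightarrow> P s \<Longrightarrow> P t \<Longrightarrow> P (s \<otimes>\<^bsub>T\<^esub> t)"
  shows "P t"
proof -
  interpret h: group_hom F T "\<lambda>u. K #>\<^bsub>F\<^esub> u"
    by unfold_locales (rule coset_hom)
  \<comment> \<open>The induction for free abelian groups proceeds through differences, so the claim
    is strengthened to a coset together with its inverse.\<close>
  have "P (K #>\<^bsub>F\<^esub> u) \<and> P (inv\<^bsub>T\<^esub> (K #>\<^bsub>F\<^esub> u))" if "Poly_Mapping.keys u \<subseteq> carrier A \<times> carrier B" for u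
    using that
  proof (induction u rule: free_Abelian_group_induct[consumes 1, case_names zero diff frag])
    case zero
    have "P \<one>\<^bsub>T\<^esub>" using elt[of "\<zero>\<^bsub>A\<^esub>" "\<zero>\<^bsub>B\<^esub>"] by (simp add: elt_zero_left)
    then show ?case using h.hom_one by simp
  next
    case (diff x y)
    have c: "x \<in> carrier F" "y \<in> carrier F" using diff by auto
    have "K #>\<^bsub>F\<^esub> (x - y) = (K #>\<^bsub>F\<^esub> x) \<otimes>\<^bsub>T\<^esub> inv\<^bsub>T\<^esub> (K #>\<^bsub>F\<^esub> y)"
      using h.hom_mult[of x "inv\<^bsub>F\<^esub> y"] h.hom_inv[of y] F.inv_closed[of y] c
        inv_free_Abelian_group[OF diff(2)]
      by (simp del: carrier_free_Abelian_group_iff inv_free_Abelian_group)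
    moreover have "inv\<^bsub>T\<^esub> ((K #>\<^bsub>F\<^esub> x) \<otimes>\<^bsub>T\<^esub> inv\<^bsub>T\<^esub> (K #>\<^bsub>F\<^esub> y)) = inv\<^bsub>T\<^esub> (K #>\<^bsub>F\<^esub> x) \<otimes>\<^bsub>T\<^esub> (K #>\<^bsub>F\<^esub> y)"
      using c by (simp add: T.inv_mult coset_closed del: carrier_free_Abelian_group_iff)
    ultimately show ?case
      using diff c by (auto intro!: mult coset_closed simp del: carrier_free_Abelian_group_iff)
  next
    case (frag p)
    then obtain a b where "p = (a, b)" "a \<in> carrier A" "b \<in> carrier B" by auto
    then show ?case
      using elt[of a b] elt[of "\<ominus>\<^bsub>A\<^esub> a" b] inv_elt[of a b] by (simp add: tensor_elt_def)
  qed
  then show ?thesis using assms(1) by (auto elim!: coset_cases)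
qed

text \<open>Uniqueness half of the universal property, immediate from generation by pure
  tensors.\<close>

lemma hom_eqI:
  assumes "group H" "h \<in> hom T H" "g \<in> hom T H" "t \<in> carrier T"
    and "\<And>a b. a \<in> carrier A \<Longrightarrow> b \<in> carrier B \<Longrightarrow> h (elt a b) = g (elt a b)"
  shows "h t = g t"
  using assms(4) by (induction rule: tensor_induct) (use assms in \<open>auto simp: hom_mult\<close>)

text \<open>Existence half of the universal property: \<open>\<beta>\<close> extends to the free
  abelian group on pairs, being balanced puts all relations into the kernel of the extension, and
  the extension factors through the quotient.\<close>

lemma ex_tensor_lift:
  assumes H: "comm_group H" and \<beta>: "balanced R A B H \<beta>"
  obtains h where "h \<in> hom T H" "\<And>a b. a \<in> carrier A \<Longrightarrow> b \<in> carrier B \<Longrightarrow> h (elt a b) = \<beta> a b"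
proof -
  interpret H: comm_group H by fact
  have "(\<lambda>(a, b). \<beta> a b) ` (carrier A \<times> carrier B) \<subseteq> carrier H"
    using \<beta> by (auto simp: balanced_def)
  then obtain g where g: "g \<in> hom F H"
      "\<And>p. p \<in> carrier A \<times> carrier B \<Longrightarrow> g (frag_of p) = (\<lambda>(a, b). \<beta> a b) p"
    by (rule H.free_Abelian_group_universal) blast
  interpret g: group_hom F H g by unfold_locales (rule g)
  \<comment> \<open>Each relation is a difference, so membership in the kernel is reduced to an
    equation between two values of \<open>g\<close>; these equations are the clauses of
    \<open>balanced\<close>.\<close>
  have gd: "u - v \<in> kernel F H g" if "u \<in> carrier F" "v \<in> carrier F" "g u = g v" for u v
  proof -
    have "u \<otimes>\<^bsub>F\<^esub> inv\<^bsub>F\<^esub> v \<in> carrier F" using that F.m_closed F.inv_closed by blast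
    moreover have "g (u \<otimes>\<^bsub>F\<^esub> inv\<^bsub>F\<^esub> v) = \<one>\<^bsub>H\<^esub>"
      using that g.hom_mult[of u "inv\<^bsub>F\<^esub> v"] g.hom_inv[of v] F.inv_closed[of v] g.hom_closed[of v]
      by simp
    ultimately show ?thesis using that by (simp add: kernel_def)
  qed
  have gs: "u + v \<in> carrier F \<and> g (u + v) = g u \<otimes>\<^bsub>H\<^esub> g v" if "u \<in> carrier F" "v \<in> carrier F" for u v
    using that g.hom_mult[of u v] F.m_closed[of u v] by simp
  have "tensor_rels R A B \<subseteq> kernel F H g"
  proof
    fix x assume "x \<in> tensor_rels R A B"
    then show "x \<in> kernel F H g"
      unfolding tensor_rels_def diff_diff_eq using \<beta>
      by (auto intro!: gd simp: g(2) gs balanced_def A.rsmult_closed B.smult_closed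
          simp del: carrier_free_Abelian_group_iff)
  qed
  then have "K \<subseteq> kernel F H g"
    unfolding tensor_ker_def by (intro F.generate_subgroup_incl g.subgroup_kernel)
  then obtain h where h: "h \<in> hom (F Mod K) H" "\<And>x. x \<in> carrier F \<Longrightarrow> h (K #>\<^bsub>F\<^esub> x) = g x"
    using g.FactGroup_universal_kernel[OF K.normal_axioms] by metis
  show thesis
  proof
    show "h \<in> hom T H" using h by (simp add: tensor_group_def)
    show "h (elt a b) = \<beta> a b" if "a \<in> carrier A" "b \<in> carrier B" for a b
      unfolding tensor_elt_def using that h(2)[OF frag_closed[OF that]] g(2)[of "(a, b)"] by simp
  qed
qed

text \<open>Justifies the description operator: the map from the existence half, restricted to the
  carrier, is a witness. Extensionality makes it the only one, as \<open>hom_eqI\<close> fixes the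
  values on the carrier.\<close>

lemma tensor_lift:
  assumes H: "comm_group H" and \<beta>: "balanced R A B H \<beta>"
  shows tensor_lift_extensional: "tensor_lift R A B H \<beta> \<in> extensional (carrier T)"
    and tensor_lift_hom: "tensor_lift R A B H \<beta> \<in> hom T H"
    and tensor_lift_elt: "a \<in> carrier A \<Longrightarrow> b \<in> carrier B \<Longrightarrow> tensor_lift R A B H \<beta> (elt a b) = \<beta> a b"
proof -
  interpret H: comm_group H by fact
  obtain h where h: "h \<in> hom T H" "\<And>a b. a \<in> carrier A \<Longrightarrow> b \<in> carrier B \<Longrightarrow> h (elt a b) = \<beta> a b"
    by (rule ex_tensor_lift[OF assms]) blast
  let ?P = "\<lambda>h. h \<in> extensional (carrier T) \<and> h \<in> hom T H \<and>
    (\<forall>a\<in>carrier A. \<forall>b\<in>carrier B. h (elt a b) = \<beta> a b)"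
  have "\<exists>!h. ?P h"
  proof (rule ex1I)
    show "?P (restrict h (carrier T))"
      using h by (simp add: hom_def elt_closed Pi_iff)
    fix g assume g: "?P g"
    show "g = restrict h (carrier T)"
    proof (rule extensionalityI[of _ "carrier T"])
      fix t assume t: "t \<in> carrier T"
      have "g t = h t" by (rule hom_eqI[OF H.is_group]) (use g h t in auto)
      then show "g t = restrict h (carrier T) t" using t by simp
    qed (use g in simp_all)
  qed
  then have *: "?P (tensor_lift R A B H \<beta>)"
    unfolding tensor_lift_def by (rule theI')
  then show "tensor_lift R A B H \<beta> \<in> extensional (carrier T)"
    and "tensor_lift R A B H \<beta> \<in> hom T H"
    and "a \<in> carrier A \<Longrightarrow> b \<in> carrier B \<Longrightarrow> tensor_lift R A B H \<beta> (elt a b) = \<beta> a b"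
    by auto
qed

end

section \<open>The left module structure on a tensor product\<close>

context tensor_product
begin

lemma tensor_simps [simp]:
  "carrier (tensor R A B) = carrier T"
  "s \<oplus>\<^bsub>tensor R A B\<^esub> t = s \<otimes>\<^bsub>T\<^esub> t"
  "\<zero>\<^bsub>tensor R A B\<^esub> = \<one>\<^bsub>T\<^esub>"
  by (simp_all add: tensor_def)

text \<open>The left scalar enters through the first factor while the balancing relation uses the
  right action on that factor; the commutation of the two actions on the bimodule \<open>A\<close>
  makes them compatible.\<close>

lemma balanced_smult:
  "r \<in> carrier R \<Longrightarrow> balanced R A B T (\<lambda>a b. elt (r \<odot>\<^bsub>A\<^esub> a) b)"
  unfolding balanced_def
  by (simp add: A.smult_closed A.smult_r_distr B.smult_closed
      elt_closed elt_add_left elt_add_right elt_balanced A.rsmult_closed flip: A.smult_rsmult)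

lemma smult_elt:
  assumes "r \<in> carrier R" "a \<in> carrier A" "b \<in> carrier B"
  shows "r \<odot>\<^bsub>tensor R A B\<^esub> elt a b = elt (r \<odot>\<^bsub>A\<^esub> a) b"
  using assms tensor_lift_elt[OF T.comm_group_axioms balanced_smult] by (simp add: tensor_def)

lemma smult_hom: "r \<in> carrier R \<Longrightarrow> (\<lambda>t. r \<odot>\<^bsub>tensor R A B\<^esub> t) \<in> hom T T"
  using tensor_lift_hom[OF T.comm_group_axioms balanced_smult] by (simp add: tensor_def)

lemma smult_mult:
  assumes "r \<in> carrier R" "s \<in> carrier T" "t \<in> carrier T"
  shows "r \<odot>\<^bsub>tensor R A B\<^esub> (s \<otimes>\<^bsub>T\<^esub> t) = (r \<odot>\<^bsub>tensor R A B\<^esub> s) \<otimes>\<^bsub>T\<^esub> (r \<odot>\<^bsub>tensor R A B\<^esub> t)"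
  using hom_mult[OF smult_hom] assms by blast

lemma tensor_smult_closed:
  "r \<in> carrier R \<Longrightarrow> t \<in> carrier T \<Longrightarrow> r \<odot>\<^bsub>tensor R A B\<^esub> t \<in> carrier T"
  using hom_in_carrier[OF smult_hom] by blast

lemma abelian_group_tensor: "abelian_group (tensor R A B)"
  by (rule abelian_groupI) (simp_all add: T.m_assoc T.l_inv_ex, rule T.m_comm)

text \<open>Serves the product case of \<open>tensor_induct\<close> for distributive laws, where the
  two induction hypotheses give four factors in the wrong order.\<close>

lemma mult_interchange:
  assumes "a \<in> carrier T" "b \<in> carrier T" "c \<in> carrier T" "d \<in> carrier T"
  shows "(a \<otimes>\<^bsub>T\<^esub> b) \<otimes>\<^bsub>T\<^esub> (c \<otimes>\<^bsub>T\<^esub> d) = (a \<otimes>\<^bsub>T\<^esub> c) \<otimes>\<^bsub>T\<^esub> (b \<otimes>\<^bsub>T\<^esub> d)"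
  using assms by (simp add: T.m_ac)

lemma left_module_tensor: "left_module R (tensor R A B)"
proof (intro left_module.intro left_module_axioms.intro abelian_group_tensor)
  show "ring R" by (rule A.R.ring_axioms)
next
  fix a b t assume ab: "a \<in> carrier R" "b \<in> carrier R" and "t \<in> carrier (tensor R A B)"
  then have t: "t \<in> carrier T" by simp
  from t show "(a \<oplus>\<^bsub>R\<^esub> b) \<odot>\<^bsub>tensor R A B\<^esub> t = a \<odot>\<^bsub>tensor R A B\<^esub> t \<oplus>\<^bsub>tensor R A B\<^esub> b \<odot>\<^bsub>tensor R A B\<^esub> t"
    by (induction rule: tensor_induct)
      (use ab in \<open>simp_all add: smult_elt smult_mult elt_add_left A.smult_l_distr A.smult_closed
        mult_interchange tensor_smult_closed\<close>)
  from t show "(a \<otimes>\<^bsub>R\<^esub> b) \<odot>\<^bsub>tensor R A B\<^esub> t = a \<odot>\<^bsub>tensor R A B\<^esub> (b \<odot>\<^bsub>tensor R A B\<^esub> t)"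
    by (induction rule: tensor_induct)
      (use ab in \<open>simp_all add: smult_elt smult_mult A.smult_assoc1 A.smult_closed tensor_smult_closed\<close>)
next
  fix t assume "t \<in> carrier (tensor R A B)"
  then have t: "t \<in> carrier T" by simp
  then show "\<one>\<^bsub>R\<^esub> \<odot>\<^bsub>tensor R A B\<^esub> t = t"
    by (induction rule: tensor_induct) (simp_all add: smult_elt smult_mult A.smult_one)
qed (simp_all add: smult_mult tensor_smult_closed)

text \<open>Linearity over \<open>R\<close> of a group homomorphism has to be tested on pure tensors
  only, since both sides are additive in the tensor.\<close>

lemma left_module_hom_tensorI:
  assumes "h \<in> hom T (add_monoid X)" "left_module R X"
    and "\<And>r a b. r \<in> carrier R \<Longrightarrow> a \<in> carrier A \<Longrightarrow> b \<in> carrier B \<Longrightarrow>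
      h (elt (r \<odot>\<^bsub>A\<^esub> a) b) = r \<odot>\<^bsub>X\<^esub> h (elt a b)"
  shows "h \<in> left_module_hom R (tensor R A B) X"
proof -
  interpret X: left_module R X by fact
  have h: "h s \<in> carrier X" "h (s \<otimes>\<^bsub>T\<^esub> t) = h s \<oplus>\<^bsub>X\<^esub> h t"
    if "s \<in> carrier T" "t \<in> carrier T" for s t
    using assms(1) that by (auto simp: hom_def)
  have "h (r \<odot>\<^bsub>tensor R A B\<^esub> t) = r \<odot>\<^bsub>X\<^esub> h t" if r: "r \<in> carrier R" and t: "t \<in> carrier T" for r t
    using t by (induction rule: tensor_induct)
      (use r assms(3) in \<open>simp_all add: smult_elt smult_mult h tensor_smult_closed X.smult_r_distr\<close>)
  then show ?thesis by (auto simp: left_module_hom_def h)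
qed

lemma left_module_hom_tensor_hom:
  "h \<in> left_module_hom R (tensor R A B) X \<Longrightarrow> h \<in> hom T (add_monoid X)"
  by (auto simp: left_module_hom_def hom_def)

lemma tensor_lift_left_module_hom:
  assumes "left_module R X" "balanced R A B (add_monoid X) \<beta>"
    and "\<And>r a b. r \<in> carrier R \<Longrightarrow> a \<in> carrier A \<Longrightarrow> b \<in> carrier B \<Longrightarrow>
      \<beta> (r \<odot>\<^bsub>A\<^esub> a) b = r \<odot>\<^bsub>X\<^esub> \<beta> a b"
  shows "tensor_lift R A B (add_monoid X) \<beta> \<in> left_module_hom R (tensor R A B) X"
    and "a \<in> carrier A \<Longrightarrow> b \<in> carrier B \<Longrightarrow> tensor_lift R A B (add_monoid X) \<beta> (elt a b) = \<beta> a b"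
proof -
  interpret X: left_module R X by fact
  note lift = tensor_lift[OF X.a_comm_group assms(2)]
  show "tensor_lift R A B (add_monoid X) \<beta> \<in> left_module_hom R (tensor R A B) X"
    using assms by (intro left_module_hom_tensorI lift(2)) (simp_all add: lift(3) A.smult_closed)
  show "a \<in> carrier A \<Longrightarrow> b \<in> carrier B \<Longrightarrow> tensor_lift R A B (add_monoid X) \<beta> (elt a b) = \<beta> a b"
    by (rule lift(3))
qed

end

section \<open>The bimodule structure on the tensor product of two bimodules\<close>

locale bimodule_tensor_product = A: bimodule R A + B: bimodule R B
  for R :: "('r, 's) ring_scheme" (structure)
    and A :: "('r, 'a, 't) bimodule_scheme"
    and B :: "('r, 'b, 'u) bimodule_scheme"
begin

sublocale tensor_product R A B
  by (intro tensor_product.intro A.bimodule_axioms B.left_module_axioms)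

abbreviation AB where "AB \<equiv> bimodule_tensor R A B"

lemma bimodule_tensor_simps [simp]:
  "carrier AB = carrier T"
  "s \<oplus>\<^bsub>AB\<^esub> t = s \<otimes>\<^bsub>T\<^esub> t"
  "\<zero>\<^bsub>AB\<^esub> = \<one>\<^bsub>T\<^esub>"
  "r \<odot>\<^bsub>AB\<^esub> t = r \<odot>\<^bsub>tensor R A B\<^esub> t"
  by (simp_all add: bimodule_tensor_def module.defs tensor_def)

lemma balanced_rsmult:
  "r \<in> carrier R \<Longrightarrow> balanced R A B T (\<lambda>a b. elt a (b \<star>\<^bsub>B\<^esub> r))"
  unfolding balanced_def
  by (simp add: B.smult_closed B.rsmult_l_distr B.rsmult_closed B.smult_rsmult
      elt_closed elt_add_left elt_add_right elt_balanced)

lemma rsmult_elt: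
  assumes "r \<in> carrier R" "a \<in> carrier A" "b \<in> carrier B"
  shows "elt a b \<star>\<^bsub>AB\<^esub> r = elt a (b \<star>\<^bsub>B\<^esub> r)"
  using assms tensor_lift_elt[OF T.comm_group_axioms balanced_rsmult]
  by (simp add: bimodule_tensor_def module.defs)

lemma rsmult_hom: "r \<in> carrier R \<Longrightarrow> (\<lambda>t. t \<star>\<^bsub>AB\<^esub> r) \<in> hom T T"
  using tensor_lift_hom[OF T.comm_group_axioms balanced_rsmult]
  by (simp add: bimodule_tensor_def module.defs)

lemma rsmult_mult:
  assumes "r \<in> carrier R" "s \<in> carrier T" "t \<in> carrier T"
  shows "(s \<otimes>\<^bsub>T\<^esub> t) \<star>\<^bsub>AB\<^esub> r = (s \<star>\<^bsub>AB\<^esub> r) \<otimes>\<^bsub>T\<^esub> (t \<star>\<^bsub>AB\<^esub> r)"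
  using hom_mult[OF rsmult_hom] assms by blast

lemma tensor_rsmult_closed:
  "r \<in> carrier R \<Longrightarrow> t \<in> carrier T \<Longrightarrow> t \<star>\<^bsub>AB\<^esub> r \<in> carrier T"
  using hom_in_carrier[OF rsmult_hom] by blast

lemma left_module_bimodule_tensor: "left_module R AB"
proof -
  interpret AB: left_module R "tensor R A B" by (rule left_module_tensor)
  show ?thesis
  proof (intro left_module.intro left_module_axioms.intro)
    show "abelian_group AB"
      by (rule abelian_groupI) (simp_all add: T.m_assoc T.l_inv_ex, rule T.m_comm)
    show "ring R" by (rule A.R.ring_axioms)
  qed (use AB.smult_closed AB.smult_l_distr AB.smult_r_distr AB.smult_assoc1 AB.smult_one
      in simp_all)
qed

lemma bimodule_bimodule_tensor: "bimodule R AB"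
proof (intro bimodule.intro bimodule_axioms.intro left_module_bimodule_tensor)
  fix t a b assume "t \<in> carrier AB" and ab: "a \<in> carrier R" "b \<in> carrier R"
  then have t: "t \<in> carrier T" by simp
  from t show "t \<star>\<^bsub>AB\<^esub> (a \<oplus>\<^bsub>R\<^esub> b) = t \<star>\<^bsub>AB\<^esub> a \<oplus>\<^bsub>AB\<^esub> t \<star>\<^bsub>AB\<^esub> b"
    by (induction rule: tensor_induct)
      (use ab in \<open>simp_all add: rsmult_elt rsmult_mult elt_add_right B.rsmult_r_distr B.rsmult_closed
        mult_interchange tensor_rsmult_closed\<close>)
  from t show "t \<star>\<^bsub>AB\<^esub> (a \<otimes>\<^bsub>R\<^esub> b) = (t \<star>\<^bsub>AB\<^esub> a) \<star>\<^bsub>AB\<^esub> b"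
    by (induction rule: tensor_induct)
      (use ab in \<open>simp_all add: rsmult_elt rsmult_mult B.rsmult_assoc B.rsmult_closed tensor_rsmult_closed\<close>)
next
  fix a t b assume "t \<in> carrier AB" and ab: "a \<in> carrier R" "b \<in> carrier R"
  then have t: "t \<in> carrier T" by simp
  then show "(a \<odot>\<^bsub>AB\<^esub> t) \<star>\<^bsub>AB\<^esub> b = a \<odot>\<^bsub>AB\<^esub> (t \<star>\<^bsub>AB\<^esub> b)"
    by (induction rule: tensor_induct)
      (use ab in \<open>simp_all add: rsmult_elt rsmult_mult smult_elt smult_mult A.smult_closed
        B.rsmult_closed tensor_rsmult_closed tensor_smult_closed\<close>)
next
  fix t assume "t \<in> carrier AB"
  then have t: "t \<in> carrier T" by simp
  then show "t \<star>\<^bsub>AB\<^esub> \<one>\<^bsub>R\<^esub> = t"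
    by (induction rule: tensor_induct) (simp_all add: rsmult_elt rsmult_mult B.rsmult_one)
qed (simp_all add: rsmult_mult tensor_rsmult_closed)

end

text \<open>Right linearity of \<open>f\<close> and left linearity of \<open>g\<close> are what the
  balancing relation demands. The result is recorded as a group homomorphism, which is enough for
  the later comparisons on pure tensors.\<close>

lemma tensor_map:
  assumes "tensor_product R A B" "tensor_product R A' B'"
    and f: "\<And>a. a \<in> carrier A \<Longrightarrow> f a \<in> carrier A'"
      "\<And>a a'. a \<in> carrier A \<Longrightarrow> a' \<in> carrier A \<Longrightarrow> f (a \<oplus>\<^bsub>A\<^esub> a') = f a \<oplus>\<^bsub>A'\<^esub> f a'"
      "\<And>a r. a \<in> carrier A \<Longrightarrow> r \<in> carrier R \<Longrightarrow> f (a \<star>\<^bsub>A\<^esub> r) = f a \<star>\<^bsub>A'\<^esub> r"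
    and g: "g \<in> left_module_hom R B B'"
  shows tensor_map_hom: "tensor_map R A B A' B' f g \<in> hom (tensor_group R A B) (tensor_group R A' B')"
    and tensor_map_elt: "a \<in> carrier A \<Longrightarrow> b \<in> carrier B \<Longrightarrow>
      tensor_map R A B A' B' f g (tensor_elt R A B a b) = tensor_elt R A' B' (f a) (g b)"
proof -
  interpret S: tensor_product R A B by fact
  interpret T: tensor_product R A' B' by fact
  have g: "\<And>b. b \<in> carrier B \<Longrightarrow> g b \<in> carrier B'"
      "\<And>b b'. b \<in> carrier B \<Longrightarrow> b' \<in> carrier B \<Longrightarrow> g (b \<oplus>\<^bsub>B\<^esub> b') = g b \<oplus>\<^bsub>B'\<^esub> g b'"
      "\<And>r b. r \<in> carrier R \<Longrightarrow> b \<in> carrier B \<Longrightarrow> g (r \<odot>\<^bsub>B\<^esub> b) = r \<odot>\<^bsub>B'\<^esub> g b"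
    using g by (auto simp: left_module_hom_def)
  have "balanced R A B (tensor_group R A' B') (\<lambda>a b. tensor_elt R A' B' (f a) (g b))"
    unfolding balanced_def
    by (simp add: f g T.elt_closed T.elt_add_left T.elt_add_right T.elt_balanced)
  from S.tensor_lift[OF T.T.comm_group_axioms this]
  show "tensor_map R A B A' B' f g \<in> hom (tensor_group R A B) (tensor_group R A' B')"
    and "a \<in> carrier A \<Longrightarrow> b \<in> carrier B \<Longrightarrow>
      tensor_map R A B A' B' f g (tensor_elt R A B a b) = tensor_elt R A' B' (f a) (g b)"
    by (auto simp: tensor_map_def)
qed

section \<open>The associativity map on iterated tensor products\<close>

locale tensor_associativity = A: bimodule R A + B: bimodule R B + X: left_module R X
  for R :: "('r, 's) ring_scheme" (structure)
    and A :: "('r, 'a, 't) bimodule_scheme"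
    and B :: "('r, 'b, 'u) bimodule_scheme"
    and X :: "('r, 'x, 'v) module_scheme"
begin

sublocale AB: bimodule_tensor_product R A B ..
sublocale BX: tensor_product R B X ..
sublocale AB_X: tensor_product R "bimodule_tensor R A B" X
  by (intro tensor_product.intro AB.bimodule_bimodule_tensor X.left_module_axioms)
sublocale A_BX: tensor_product R A "tensor R B X"
  by (intro tensor_product.intro A.bimodule_axioms BX.left_module_tensor)

abbreviation inner where
  "inner a \<equiv> tensor_lift R B X AB_X.T (\<lambda>b x. AB_X.elt (AB.elt a b) x)"

text \<open>A scalar between \<open>b\<close> and \<open>x\<close> is moved in two stages: the right
  action on the tensor of \<open>a\<close> and \<open>b\<close> acts through \<open>b\<close>, and
  the outer tensor product passes it on to \<open>x\<close>.\<close>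

lemma balanced_inner: "a \<in> carrier A \<Longrightarrow> balanced R B X AB_X.T (\<lambda>b x. AB_X.elt (AB.elt a b) x)"
  unfolding balanced_def
  by (simp add: AB.elt_closed AB.elt_add_right AB_X.elt_closed AB_X.elt_add_right AB.rsmult_elt
      AB_X.elt_add_left[simplified] flip: AB_X.elt_balanced)

lemmas inner = BX.tensor_lift[OF AB_X.T.comm_group_axioms balanced_inner]

lemma inner_closed: "a \<in> carrier A \<Longrightarrow> t \<in> carrier BX.T \<Longrightarrow> inner a t \<in> carrier AB_X.T"
  using hom_in_carrier[OF inner(2)] by blast

lemma inner_mult:
  "a \<in> carrier A \<Longrightarrow> s \<in> carrier BX.T \<Longrightarrow> t \<in> carrier BX.T \<Longrightarrow>
    inner a (s \<otimes>\<^bsub>BX.T\<^esub> t) = inner a s \<otimes>\<^bsub>AB_X.T\<^esub> inner a t"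
  using hom_mult[OF inner(2)] by blast

text \<open>Additivity and balancing in the outer variable are equations between maps on the inner
  tensor product, hence checked by induction on its elements. For balancing, the relation used is
  the one between \<open>a\<close> and \<open>b\<close>.\<close>

lemma balanced_outer: "balanced R A (tensor R B X) AB_X.T inner"
proof -
  have "inner (a \<oplus>\<^bsub>A\<^esub> a') t = inner a t \<otimes>\<^bsub>AB_X.T\<^esub> inner a' t"
    if a: "a \<in> carrier A" "a' \<in> carrier A" and t: "t \<in> carrier BX.T" for a a' t
    using t by (induction rule: BX.tensor_induct)
      (use a in \<open>simp_all add: inner(3) inner_mult inner_closed AB.elt_add_left AB.elt_closed
        AB_X.elt_add_left[simplified] AB_X.mult_interchange\<close>)
  moreover have "inner (a \<star>\<^bsub>A\<^esub> r) t = inner a (r \<odot>\<^bsub>tensor R B X\<^esub> t)"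
    if a: "a \<in> carrier A" "r \<in> carrier R" and t: "t \<in> carrier BX.T" for a r t
    using t by (induction rule: BX.tensor_induct)
      (use a in \<open>simp_all add: inner(3) inner_mult inner_closed A.rsmult_closed BX.smult_elt
        B.smult_closed BX.smult_mult BX.tensor_smult_closed AB.elt_balanced\<close>)
  ultimately show ?thesis
    unfolding balanced_def by (simp add: inner_closed inner_mult)
qed

lemma tensor_assoc_hom: "tensor_assoc R A B X \<in> hom A_BX.T AB_X.T"
  unfolding tensor_assoc_def
  by (rule A_BX.tensor_lift_hom[OF AB_X.T.comm_group_axioms balanced_outer])

lemma tensor_assoc_elt:
  assumes "a \<in> carrier A" "b \<in> carrier B" "x \<in> carrier X"
  shows "tensor_assoc R A B X (A_BX.elt a (BX.elt b x)) = AB_X.elt (AB.elt a b) x"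
  unfolding tensor_assoc_def
  using A_BX.tensor_lift_elt[OF AB_X.T.comm_group_axioms balanced_outer, of a "BX.elt b x"] assms
  by (simp add: BX.elt_closed inner(3))

text \<open>Uniqueness of lifts, applied once in the outer and once in the inner tensor product. It
  turns the compatibility condition on objects into an equation between elements.\<close>

lemma iterated_hom_eqI:
  assumes "group H" "h \<in> hom A_BX.T H" "g \<in> hom A_BX.T H" "t \<in> carrier A_BX.T"
    and eq: "\<And>a b x. a \<in> carrier A \<Longrightarrow> b \<in> carrier B \<Longrightarrow> x \<in> carrier X \<Longrightarrow>
      h (A_BX.elt a (BX.elt b x)) = g (A_BX.elt a (BX.elt b x))"
  shows "h t = g t"
proof (rule A_BX.hom_eqI[OF assms(1-4)])
  fix a s assume a: "a \<in> carrier A" and "s \<in> carrier (tensor R B X)"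
  then have "s \<in> carrier BX.T" by simp
  then show "h (A_BX.elt a s) = g (A_BX.elt a s)"
    by (induction rule: BX.tensor_induct)
      (use a eq assms in \<open>simp_all add: A_BX.elt_add_right[simplified] A_BX.elt_closed hom_mult\<close>)
qed

end

section \<open>Finite sums\<close>

text \<open>Zero goes to zero because its image is idempotent. With \<open>h\<close> the identity,
  the lemma also transfers sums between two records that share their additive group.\<close>

lemma additive_finsum:
  assumes X: "abelian_group X" and Y: "abelian_group Y"
    and cl: "\<And>x. x \<in> carrier X \<Longrightarrow> h x \<in> carrier Y"
    and add: "\<And>x y. x \<in> carrier X \<Longrightarrow> y \<in> carrier X \<Longrightarrow> h (x \<oplus>\<^bsub>X\<^esub> y) = h x \<oplus>\<^bsub>Y\<^esub> h y"
    and "finite A" "\<And>i. i \<in> A \<Longrightarrow> f i \<in> carrier X"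
  shows "h (finsum X f A) = finsum Y (\<lambda>i. h (f i)) A"
proof -
  interpret X: abelian_group X by fact
  interpret Y: abelian_group Y by fact
  have "h \<zero>\<^bsub>X\<^esub> \<oplus>\<^bsub>Y\<^esub> h \<zero>\<^bsub>X\<^esub> = h \<zero>\<^bsub>X\<^esub>" using add[of "\<zero>\<^bsub>X\<^esub>" "\<zero>\<^bsub>X\<^esub>"] by simp
  then have 0: "h \<zero>\<^bsub>X\<^esub> = \<zero>\<^bsub>Y\<^esub>" using cl[of "\<zero>\<^bsub>X\<^esub>"] by (simp add: Y.add.r_cancel_one)
  show ?thesis
    using assms(5,6) by (induction A rule: finite_induct) (simp_all add: 0 add cl Pi_iff)
qed

lemma (in abelian_monoid) finsum_swap:
  assumes "finite A" "finite B" "\<And>i j. i \<in> A \<Longrightarrow> j \<in> B \<Longrightarrow> c i j \<in> carrier G"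
  shows "finsum G (\<lambda>i. finsum G (\<lambda>j. c i j) B) A = finsum G (\<lambda>j. finsum G (\<lambda>i. c i j) A) B"
  using assms(1,3)
proof (induction A rule: finite_induct)
  case empty
  then show ?case by (simp add: finsum_zero)
next
  case (insert i A)
  have "finsum G (\<lambda>j. finsum G (\<lambda>i. c i j) (insert i A)) B =
      finsum G (\<lambda>j. c i j \<oplus> finsum G (\<lambda>i. c i j) A) B"
    using insert by (intro finsum_cong') (auto simp: Pi_iff)
  also have "\<dots> = finsum G (\<lambda>j. c i j) B \<oplus> finsum G (\<lambda>j. finsum G (\<lambda>i. c i j) A) B"
    using insert by (intro finsum_addf) (auto simp: Pi_iff)
  finally show ?case using insert by (simp add: Pi_iff)
qed

text \<open>Regroups a sum over total degrees \<open>k\<close> and splittings of \<open>k\<close> as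
  a sum over pairs of degrees. Pairs of total degree above \<open>n\<close> are absent on the left
  and filled with zeros on the right.\<close>

lemma (in abelian_monoid) finsum_convolution:
  fixes n :: nat
  assumes c: "\<And>i j. 1 \<le> i \<Longrightarrow> 1 \<le> j \<Longrightarrow> i + j \<le> n \<Longrightarrow> c i j \<in> carrier G"
  shows "finsum G (\<lambda>k. finsum G (\<lambda>i. c i (k - i)) {1..<k}) {1..n} =
    finsum G (\<lambda>i. finsum G (\<lambda>j. if i + j \<le> n then c i j else \<zero>) {1..n}) {1..n}"
proof -
  \<comment> \<open>Zeros make the inner range independent of \<open>k\<close>, so that the order of
    summation can be exchanged.\<close>
  have "finsum G (\<lambda>k. finsum G (\<lambda>i. c i (k - i)) {1..<k}) {1..n} =
      finsum G (\<lambda>k. finsum G (\<lambda>i. if i < k then c i (k - i) else \<zero>) {1..n}) {1..n}"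
    by (rule finsum_cong'[OF refl _ add.finprod_mono_neutral_cong_left]) (auto intro!: finsum_closed c)
  also have "\<dots> = finsum G (\<lambda>i. finsum G (\<lambda>k. if i < k then c i (k - i) else \<zero>) {1..n}) {1..n}"
    by (rule finsum_swap) (auto intro!: c)
  also have "\<dots> = finsum G (\<lambda>i. finsum G (\<lambda>j. if i + j \<le> n then c i j else \<zero>) {1..n}) {1..n}"
  proof (rule finsum_cong'[OF refl])
    fix i assume i: "i \<in> {1..n}"
    \<comment> \<open>For fixed \<open>i\<close>, the indices \<open>k\<close> that contribute are
      exactly \<open>i + j\<close> with \<open>j\<close> in \<open>{1..n - i}\<close>.\<close>
    have "finsum G (\<lambda>k. if i < k then c i (k - i) else \<zero>) {1..n} =
        finsum G (\<lambda>k. c i (k - i)) ((+) i ` {1..n - i})"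
      using i by (intro add.finprod_mono_neutral_cong_right)
        (auto intro!: c simp: image_iff Bex_def intro: exI[of _ "_ - i"])
    also have "\<dots> = finsum G (\<lambda>j. c i (i + j - i)) {1..n - i}"
      using i by (intro finsum_reindex) (auto intro!: c)
    also have "\<dots> = finsum G (\<lambda>j. if i + j \<le> n then c i j else \<zero>) {1..n}"
      using i by (intro add.finprod_mono_neutral_cong_left) (auto intro!: c)
    finally show "finsum G (\<lambda>k. if i < k then c i (k - i) else \<zero>) {1..n} =
        finsum G (\<lambda>j. if i + j \<le> n then c i j else \<zero>) {1..n}" .
  qed (auto intro!: finsum_closed c)
  finally show ?thesis .
qed


text \<open>Source of the zero laws below: an additive map sends zero to an idempotent.\<close>

lemma (in abelian_group) idem_zero:
  assumes "x \<in> carrier G" "x \<oplus> x = x"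
  shows "x = \<zero>"
  using assms by (simp add: add.r_cancel_one)

lemma (in left_module) smult_r_zero: "a \<in> carrier R \<Longrightarrow> a \<odot>\<^bsub>M\<^esub> \<zero>\<^bsub>M\<^esub> = \<zero>\<^bsub>M\<^esub>"
  using smult_r_distr[of a "\<zero>\<^bsub>M\<^esub>" "\<zero>\<^bsub>M\<^esub>"] by (intro M.idem_zero) (simp_all add: smult_closed)

lemma (in left_module) smult_l_zero: "x \<in> carrier M \<Longrightarrow> \<zero> \<odot>\<^bsub>M\<^esub> x = \<zero>\<^bsub>M\<^esub>"
  using smult_l_distr[of "\<zero>" "\<zero>" x] by (intro M.idem_zero) (simp_all add: smult_closed)

lemma (in bimodule) rsmult_l_zero: "a \<in> carrier R \<Longrightarrow> \<zero>\<^bsub>M\<^esub> \<star>\<^bsub>M\<^esub> a = \<zero>\<^bsub>M\<^esub>"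
  using rsmult_l_distr[of "\<zero>\<^bsub>M\<^esub>" "\<zero>\<^bsub>M\<^esub>" a] by (intro M.idem_zero) (simp_all add: rsmult_closed)

lemma (in bimodule) rsmult_r_zero: "x \<in> carrier M \<Longrightarrow> x \<star>\<^bsub>M\<^esub> \<zero> = \<zero>\<^bsub>M\<^esub>"
  using rsmult_r_distr[of x "\<zero>" "\<zero>"] by (intro M.idem_zero) (simp_all add: rsmult_closed)


section \<open>Graded actions\<close>

locale trivial_extension =
  fixes n :: nat
    and R :: "('r, 's) ring_scheme" (structure)
    and M :: "nat \<Rightarrow> ('r, 'm) bimodule"
    and \<Phi> :: "nat \<Rightarrow> nat \<Rightarrow> ('m, 'm) tens \<Rightarrow> 'm"
  assumes ring_R: "ring R"
    and bimodule_M: "i \<in> {1..n} \<Longrightarrow> bimodule R (M i)"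
    and products: "associative_products n R M \<Phi>"
begin

declare One_nat_def [simp del]

sublocale R: ring R by (rule ring_R)

abbreviation mul where "mul \<equiv> phi_prod R M \<Phi>"
abbreviation S where "S \<equiv> trivial_extension_ring n R M \<Phi>"

lemma left_module_M: "i \<in> {1..n} \<Longrightarrow> left_module R (M i)"
  by (rule bimodule.axioms(1)[OF bimodule_M])

lemma abelian_group_M: "i \<in> {1..n} \<Longrightarrow> abelian_group (M i)"
  by (rule left_module.axioms(2)[OF left_module_M])

lemmas M_left_rules =
  left_module.smult_closed[OF left_module_M]
  left_module.smult_l_distr[OF left_module_M]
  left_module.smult_r_distr[OF left_module_M]
  left_module.smult_assoc1[OF left_module_M]
  left_module.smult_one[OF left_module_M]

lemmas M_right_rules =
  bimodule.rsmult_closed[OF bimodule_M]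
  bimodule.rsmult_l_distr[OF bimodule_M]
  bimodule.rsmult_r_distr[OF bimodule_M]
  bimodule.rsmult_assoc[OF bimodule_M]
  bimodule.rsmult_one[OF bimodule_M]
  bimodule.smult_rsmult[OF bimodule_M]

lemmas M_rules = M_left_rules M_right_rules

lemmas M_add_rules =
  abelian_groupE(1)[OF abelian_group_M]
  abelian_groupE(2)[OF abelian_group_M]
  abelian_groupE(3)[OF abelian_group_M]
  abelian_groupE(5)[OF abelian_group_M]
  abelian_monoid.r_zero[OF abelian_group.axioms(1)[OF abelian_group_M]]

lemmas M_comm = abelian_groupE(4)[OF abelian_group_M]

lemma M_zero_rules:
  assumes "i \<in> {1..n}"
  shows "r \<in> carrier R \<Longrightarrow> r \<odot>\<^bsub>M i\<^esub> \<zero>\<^bsub>M i\<^esub> = \<zero>\<^bsub>M i\<^esub>"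
    and "x \<in> carrier (M i) \<Longrightarrow> \<zero> \<odot>\<^bsub>M i\<^esub> x = \<zero>\<^bsub>M i\<^esub>"
    and "r \<in> carrier R \<Longrightarrow> \<zero>\<^bsub>M i\<^esub> \<star>\<^bsub>M i\<^esub> r = \<zero>\<^bsub>M i\<^esub>"
    and "x \<in> carrier (M i) \<Longrightarrow> x \<star>\<^bsub>M i\<^esub> \<zero> = \<zero>\<^bsub>M i\<^esub>"
proof -
  interpret Mi: bimodule R "M i" using assms by (rule bimodule_M)
  show "r \<in> carrier R \<Longrightarrow> r \<odot>\<^bsub>M i\<^esub> \<zero>\<^bsub>M i\<^esub> = \<zero>\<^bsub>M i\<^esub>"
    and "x \<in> carrier (M i) \<Longrightarrow> \<zero> \<odot>\<^bsub>M i\<^esub> x = \<zero>\<^bsub>M i\<^esub>"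
    by (rule Mi.smult_r_zero Mi.smult_l_zero, assumption)+
  show "r \<in> carrier R \<Longrightarrow> \<zero>\<^bsub>M i\<^esub> \<star>\<^bsub>M i\<^esub> r = \<zero>\<^bsub>M i\<^esub>"
    and "x \<in> carrier (M i) \<Longrightarrow> x \<star>\<^bsub>M i\<^esub> \<zero> = \<zero>\<^bsub>M i\<^esub>"
    by (rule Mi.rsmult_l_zero Mi.rsmult_r_zero, assumption)+
qed

text \<open>Elementwise laws of the products: left and right linearity come from
  \<open>\<Phi> i j\<close> being a bimodule homomorphism, additivity in each factor and balancing
  also from the relations in the tensor product.\<close>

lemma mul_rules:
  assumes "1 \<le> i" "1 \<le> j" "i + j \<le> n"
  shows mul_closed: "x \<in> carrier (M i) \<Longrightarrow> y \<in> carrier (M j) \<Longrightarrow> mul i j x y \<in> carrier (M (i + j))"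
    and mul_add_left: "x \<in> carrier (M i) \<Longrightarrow> x' \<in> carrier (M i) \<Longrightarrow> y \<in> carrier (M j) \<Longrightarrow>
      mul i j (x \<oplus>\<^bsub>M i\<^esub> x') y = mul i j x y \<oplus>\<^bsub>M (i + j)\<^esub> mul i j x' y"
    and mul_add_right: "x \<in> carrier (M i) \<Longrightarrow> y \<in> carrier (M j) \<Longrightarrow> y' \<in> carrier (M j) \<Longrightarrow>
      mul i j x (y \<oplus>\<^bsub>M j\<^esub> y') = mul i j x y \<oplus>\<^bsub>M (i + j)\<^esub> mul i j x y'"
    and mul_smult_left: "r \<in> carrier R \<Longrightarrow> x \<in> carrier (M i) \<Longrightarrow> y \<in> carrier (M j) \<Longrightarrow>
      mul i j (r \<odot>\<^bsub>M i\<^esub> x) y = r \<odot>\<^bsub>M (i + j)\<^esub> mul i j x y"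
    and mul_balanced: "r \<in> carrier R \<Longrightarrow> x \<in> carrier (M i) \<Longrightarrow> y \<in> carrier (M j) \<Longrightarrow>
      mul i j (x \<star>\<^bsub>M i\<^esub> r) y = mul i j x (r \<odot>\<^bsub>M j\<^esub> y)"
    and mul_rsmult_right: "r \<in> carrier R \<Longrightarrow> x \<in> carrier (M i) \<Longrightarrow> y \<in> carrier (M j) \<Longrightarrow>
      mul i j x (y \<star>\<^bsub>M j\<^esub> r) = mul i j x y \<star>\<^bsub>M (i + j)\<^esub> r"
proof -
  interpret T: bimodule_tensor_product R "M i" "M j"
    using assms by (intro bimodule_tensor_product.intro bimodule_M) auto
  have "\<Phi> i j \<in> bimodule_hom R T.AB (M (i + j))"
    using products assms by (auto simp: associative_products_def)
  then have \<Phi>: "t \<in> carrier T.T \<Longrightarrow> \<Phi> i j t \<in> carrier (M (i + j))"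
    "s \<in> carrier T.T \<Longrightarrow> t \<in> carrier T.T \<Longrightarrow> \<Phi> i j (s \<otimes>\<^bsub>T.T\<^esub> t) = \<Phi> i j s \<oplus>\<^bsub>M (i + j)\<^esub> \<Phi> i j t"
    "r \<in> carrier R \<Longrightarrow> t \<in> carrier T.T \<Longrightarrow> \<Phi> i j (r \<odot>\<^bsub>tensor R (M i) (M j)\<^esub> t) = r \<odot>\<^bsub>M (i + j)\<^esub> \<Phi> i j t"
    "r \<in> carrier R \<Longrightarrow> t \<in> carrier T.T \<Longrightarrow> \<Phi> i j (t \<star>\<^bsub>T.AB\<^esub> r) = \<Phi> i j t \<star>\<^bsub>M (i + j)\<^esub> r" for r s t
    by (auto simp: bimodule_hom_def left_module_hom_def)
  show "x \<in> carrier (M i) \<Longrightarrow> y \<in> carrier (M j) \<Longrightarrow> mul i j x y \<in> carrier (M (i + j))"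
    and "x \<in> carrier (M i) \<Longrightarrow> x' \<in> carrier (M i) \<Longrightarrow> y \<in> carrier (M j) \<Longrightarrow>
      mul i j (x \<oplus>\<^bsub>M i\<^esub> x') y = mul i j x y \<oplus>\<^bsub>M (i + j)\<^esub> mul i j x' y"
    and "x \<in> carrier (M i) \<Longrightarrow> y \<in> carrier (M j) \<Longrightarrow> y' \<in> carrier (M j) \<Longrightarrow>
      mul i j x (y \<oplus>\<^bsub>M j\<^esub> y') = mul i j x y \<oplus>\<^bsub>M (i + j)\<^esub> mul i j x y'"
    and "r \<in> carrier R \<Longrightarrow> x \<in> carrier (M i) \<Longrightarrow> y \<in> carrier (M j) \<Longrightarrow>
      mul i j (r \<odot>\<^bsub>M i\<^esub> x) y = r \<odot>\<^bsub>M (i + j)\<^esub> mul i j x y"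
    and "r \<in> carrier R \<Longrightarrow> x \<in> carrier (M i) \<Longrightarrow> y \<in> carrier (M j) \<Longrightarrow>
      mul i j (x \<star>\<^bsub>M i\<^esub> r) y = mul i j x (r \<odot>\<^bsub>M j\<^esub> y)"
    and "r \<in> carrier R \<Longrightarrow> x \<in> carrier (M i) \<Longrightarrow> y \<in> carrier (M j) \<Longrightarrow>
      mul i j x (y \<star>\<^bsub>M j\<^esub> r) = mul i j x y \<star>\<^bsub>M (i + j)\<^esub> r"
    by (simp_all add: phi_prod_def T.elt_closed T.elt_add_left T.elt_add_right T.elt_balanced \<Phi>
        flip: T.smult_elt T.rsmult_elt)
qed

lemma mul_zero_right:
  "\<lbrakk>1 \<le> i; 1 \<le> j; i + j \<le> n; x \<in> carrier (M i)\<rbrakk> \<Longrightarrow> mul i j x \<zero>\<^bsub>M j\<^esub> = \<zero>\<^bsub>M (i + j)\<^esub>"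
  by (rule abelian_group.idem_zero[OF abelian_group_M])
    (auto simp: M_add_rules mul_closed simp flip: mul_add_right)

lemma mul_assoc:
  "\<lbrakk>1 \<le> i; 1 \<le> j; 1 \<le> k; i + j + k \<le> n; x \<in> carrier (M i); y \<in> carrier (M j); z \<in> carrier (M k)\<rbrakk> \<Longrightarrow>
    mul (i + j) k (mul i j x y) z = mul i (j + k) x (mul j k y z)"
  using products by (auto simp: associative_products_def)

lemma S_eqI:
  assumes "s \<in> carrier S" "t \<in> carrier S" "fst s = fst t" "\<And>k. k \<in> {1..n} \<Longrightarrow> snd s k = snd t k"
  shows "s = t"
proof -
  have "snd s \<in> (\<Pi>\<^sub>E i\<in>{1..n}. carrier (M i))" "snd t \<in> (\<Pi>\<^sub>E i\<in>{1..n}. carrier (M i))"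
    using assms(1,2) by (auto simp: trivial_extension_ring_def)
  then have "snd s = snd t" using assms(4) by (rule PiE_ext)
  with assms(3) show ?thesis by (rule prod_eqI)
qed

lemma S_carrierI:
  assumes "r \<in> carrier R" "\<And>k. k \<in> {1..n} \<Longrightarrow> f k \<in> carrier (M k)"
  shows "(r, \<lambda>k\<in>{1..n}. f k) \<in> carrier S"
  using assms by (simp add: trivial_extension_ring_def)

lemma S_fst: "s \<in> carrier S \<Longrightarrow> fst s \<in> carrier R"
  and S_snd: "s \<in> carrier S \<Longrightarrow> k \<in> {1..n} \<Longrightarrow> snd s k \<in> carrier (M k)"
  by (auto simp: trivial_extension_ring_def)

lemma S_proj [simp]:
  "fst (s \<oplus>\<^bsub>S\<^esub> t) = fst s \<oplus> fst t"
  "k \<in> {1..n} \<Longrightarrow> snd (s \<oplus>\<^bsub>S\<^esub> t) k = snd s k \<oplus>\<^bsub>M k\<^esub> snd t k"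
  "fst \<zero>\<^bsub>S\<^esub> = \<zero>"
  "k \<in> {1..n} \<Longrightarrow> snd \<zero>\<^bsub>S\<^esub> k = \<zero>\<^bsub>M k\<^esub>"
  "fst \<one>\<^bsub>S\<^esub> = \<one>"
  "k \<in> {1..n} \<Longrightarrow> snd \<one>\<^bsub>S\<^esub> k = \<zero>\<^bsub>M k\<^esub>"
  "fst (s \<otimes>\<^bsub>S\<^esub> t) = fst s \<otimes> fst t"
  by (simp_all add: trivial_extension_ring_def split_beta)

lemma snd_mult:
  "k \<in> {1..n} \<Longrightarrow> snd (s \<otimes>\<^bsub>S\<^esub> t) k =
    fst s \<odot>\<^bsub>M k\<^esub> snd t k \<oplus>\<^bsub>M k\<^esub> finsum (M k) (\<lambda>i. mul i (k - i) (snd s i) (snd t (k - i))) {1..<k}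
      \<oplus>\<^bsub>M k\<^esub> snd s k \<star>\<^bsub>M k\<^esub> fst t"
  by (simp add: trivial_extension_ring_def split_beta)

lemma mul_closed_diff: "i < k \<Longrightarrow> i \<in> {1..n} \<Longrightarrow> k \<in> {1..n} \<Longrightarrow> x \<in> carrier (M i) \<Longrightarrow>
    y \<in> carrier (M (k - i)) \<Longrightarrow> mul i (k - i) x y \<in> carrier (M k)"
  using mul_closed[of i "k - i" x y] by auto

lemma convolution_term_closed:
  assumes "k \<in> {1..n}" "i \<in> {1..<k}" "s \<in> carrier S" "t \<in> carrier S"
  shows "mul i (k - i) (snd s i) (snd t (k - i)) \<in> carrier (M k)"
  using assms by (intro mul_closed_diff S_snd) auto

lemma convolution_closed:
  assumes "k \<in> {1..n}" "s \<in> carrier S" "t \<in> carrier S"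
  shows "finsum (M k) (\<lambda>i. mul i (k - i) (snd s i) (snd t (k - i))) {1..<k} \<in> carrier (M k)"
proof -
  interpret Mk: abelian_group "M k" using assms by (intro abelian_group_M)
  show ?thesis using assms by (intro Mk.finsum_closed Pi_I convolution_term_closed)
qed

lemma S_closed:
  assumes "s \<in> carrier S" "t \<in> carrier S"
  shows S_add_closed: "s \<oplus>\<^bsub>S\<^esub> t \<in> carrier S"
    and S_mult_closed: "s \<otimes>\<^bsub>S\<^esub> t \<in> carrier S"
proof -
  have "s \<oplus>\<^bsub>S\<^esub> t = (fst s \<oplus> fst t, \<lambda>k\<in>{1..n}. snd s k \<oplus>\<^bsub>M k\<^esub> snd t k)"
    by (simp add: trivial_extension_ring_def split_beta)
  also have "\<dots> \<in> carrier S"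
    using assms by (intro S_carrierI) (auto simp: S_fst S_snd M_add_rules simp del: atLeastAtMost_iff)
  finally show "s \<oplus>\<^bsub>S\<^esub> t \<in> carrier S" .
  have "s \<otimes>\<^bsub>S\<^esub> t = (fst s \<otimes> fst t, \<lambda>k\<in>{1..n}.
      fst s \<odot>\<^bsub>M k\<^esub> snd t k \<oplus>\<^bsub>M k\<^esub> finsum (M k) (\<lambda>i. mul i (k - i) (snd s i) (snd t (k - i))) {1..<k}
        \<oplus>\<^bsub>M k\<^esub> snd s k \<star>\<^bsub>M k\<^esub> fst t)"
    by (simp add: trivial_extension_ring_def split_beta)
  also have "\<dots> \<in> carrier S"
    using assms convolution_closed[OF _ assms]
    by (intro S_carrierI) (auto simp: S_fst S_snd M_add_rules M_rules simp del: atLeastAtMost_iff)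
  finally show "s \<otimes>\<^bsub>S\<^esub> t \<in> carrier S" .
qed

lemma S_zero_closed: "\<zero>\<^bsub>S\<^esub> \<in> carrier S"
  and S_one_closed: "\<one>\<^bsub>S\<^esub> \<in> carrier S"
  by (auto simp: trivial_extension_ring_def M_add_rules)

lemma abelian_group_S: "abelian_group S"
proof (rule abelian_groupI)
  fix s assume s: "s \<in> carrier S"
  let ?t = "(\<ominus> fst s, \<lambda>k\<in>{1..n}. \<ominus>\<^bsub>M k\<^esub> snd s k)"
  have "?t \<in> carrier S"
    using s by (intro S_carrierI) (auto simp: S_fst S_snd abelian_group.a_inv_closed[OF abelian_group_M])
  moreover have "?t \<oplus>\<^bsub>S\<^esub> s = \<zero>\<^bsub>S\<^esub>"
    using s calculation
    by (intro S_eqI) (auto simp: S_add_closed S_zero_closed S_fst S_snd R.l_neg abelian_group.l_neg[OF abelian_group_M])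
  ultimately show "\<exists>t\<in>carrier S. t \<oplus>\<^bsub>S\<^esub> s = \<zero>\<^bsub>S\<^esub>" by blast
next
  fix s t assume "s \<in> carrier S" "t \<in> carrier S"
  then show "s \<oplus>\<^bsub>S\<^esub> t = t \<oplus>\<^bsub>S\<^esub> s"
    by (intro S_eqI) (simp_all add: S_add_closed S_fst S_snd R.a_comm M_comm)
qed ((intro S_eqI)?; simp add: S_add_closed S_zero_closed S_fst S_snd R.a_assoc M_add_rules)+

lemma finsum_S:
  assumes "finite A" "\<And>i. i \<in> A \<Longrightarrow> f i \<in> carrier S"
  shows fst_finsum: "fst (finsum S f A) = finsum R (\<lambda>i. fst (f i)) A"
    and snd_finsum: "k \<in> {1..n} \<Longrightarrow> snd (finsum S f A) k = finsum (M k) (\<lambda>i. snd (f i) k) A"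
proof -
  show "fst (finsum S f A) = finsum R (\<lambda>i. fst (f i)) A"
    by (rule additive_finsum[OF abelian_group_S R.abelian_group_axioms _ _ assms]) (auto simp: S_fst)
  show "snd (finsum S f A) k = finsum (M k) (\<lambda>i. snd (f i) k) A" if "k \<in> {1..n}"
    by (rule additive_finsum[OF abelian_group_S abelian_group_M _ _ assms, where h = "\<lambda>s. snd s k"])
      (use that in \<open>auto simp: S_snd\<close>)
qed

end

section \<open>Actions of the graded pieces on a module and the induced action of the
  extension\<close>

definition graded_smult ::
  "nat \<Rightarrow> ('r, 'x, 'v) module_scheme \<Rightarrow> (nat \<Rightarrow> 'm \<Rightarrow> 'x \<Rightarrow> 'x) \<Rightarrow> 'r \<times> (nat \<Rightarrow> 'm) \<Rightarrow> 'x \<Rightarrow> 'x"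
  where "graded_smult n X a s x =
    fst s \<odot>\<^bsub>X\<^esub> x \<oplus>\<^bsub>X\<^esub> finsum X (\<lambda>i. a i (snd s i) x) {1..n}"

text \<open>\<open>act_smult\<close> expresses linearity of the structure maps,
  \<open>act_balanced\<close> the tensor relation, and \<open>act_act\<close> merges both
  compatibility conditions on an object. Nothing is presupposed about \<open>S\<close> as a ring, so
  the module underlying \<open>S\<close> may serve as \<open>X\<close>.\<close>

locale graded_action = trivial_extension n R M \<Phi> + X: left_module R X
  for n and R :: "('r, 's) ring_scheme" (structure)
    and M :: "nat \<Rightarrow> ('r, 'm) bimodule" and \<Phi>
    and X :: "('r, 'x, 'v) module_scheme" +
  fixes a :: "nat \<Rightarrow> 'm \<Rightarrow> 'x \<Rightarrow> 'x"
  assumes act_closed: "\<lbrakk>i \<in> {1..n}; m \<in> carrier (M i); x \<in> carrier X\<rbrakk> \<Longrightarrow> a i m x \<in> carrier X"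
    and act_add_left: "\<lbrakk>i \<in> {1..n}; m \<in> carrier (M i); m' \<in> carrier (M i); x \<in> carrier X\<rbrakk> \<Longrightarrow>
      a i (m \<oplus>\<^bsub>M i\<^esub> m') x = a i m x \<oplus>\<^bsub>X\<^esub> a i m' x"
    and act_add_right: "\<lbrakk>i \<in> {1..n}; m \<in> carrier (M i); x \<in> carrier X; x' \<in> carrier X\<rbrakk> \<Longrightarrow>
      a i m (x \<oplus>\<^bsub>X\<^esub> x') = a i m x \<oplus>\<^bsub>X\<^esub> a i m x'"
    and act_smult: "\<lbrakk>i \<in> {1..n}; r \<in> carrier R; m \<in> carrier (M i); x \<in> carrier X\<rbrakk> \<Longrightarrow>
      a i (r \<odot>\<^bsub>M i\<^esub> m) x = r \<odot>\<^bsub>X\<^esub> a i m x"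
    and act_balanced: "\<lbrakk>i \<in> {1..n}; r \<in> carrier R; m \<in> carrier (M i); x \<in> carrier X\<rbrakk> \<Longrightarrow>
      a i (m \<star>\<^bsub>M i\<^esub> r) x = a i m (r \<odot>\<^bsub>X\<^esub> x)"
    and act_act: "\<lbrakk>i \<in> {1..n}; j \<in> {1..n}; m \<in> carrier (M i); m' \<in> carrier (M j); x \<in> carrier X\<rbrakk> \<Longrightarrow>
      a i m (a j m' x) = (if i + j \<le> n then a (i + j) (mul i j m m') x else \<zero>\<^bsub>X\<^esub>)"
begin

abbreviation act where "act \<equiv> graded_smult n X a"

lemma act_zero: "i \<in> {1..n} \<Longrightarrow> x \<in> carrier X \<Longrightarrow> a i \<zero>\<^bsub>M i\<^esub> x = \<zero>\<^bsub>X\<^esub>"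
  using act_add_left[of i "\<zero>\<^bsub>M i\<^esub>" "\<zero>\<^bsub>M i\<^esub>" x]
  by (intro X.M.idem_zero) (simp_all add: M_add_rules act_closed)

lemma sum_closed: "s \<in> carrier S \<Longrightarrow> x \<in> carrier X \<Longrightarrow> finsum X (\<lambda>i. a i (snd s i) x) {1..n} \<in> carrier X"
  by (intro X.M.finsum_closed Pi_I act_closed S_snd)

lemma graded_smult_closed: "s \<in> carrier S \<Longrightarrow> x \<in> carrier X \<Longrightarrow> act s x \<in> carrier X"
  unfolding graded_smult_def by (intro X.M.a_closed X.smult_closed sum_closed S_fst)

lemma add_interchange:
  assumes "p \<in> carrier X" "q \<in> carrier X" "p' \<in> carrier X" "q' \<in> carrier X"
  shows "(p \<oplus>\<^bsub>X\<^esub> p') \<oplus>\<^bsub>X\<^esub> (q \<oplus>\<^bsub>X\<^esub> q') = (p \<oplus>\<^bsub>X\<^esub> q) \<oplus>\<^bsub>X\<^esub> (p' \<oplus>\<^bsub>X\<^esub> q')"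
  using assms by (simp add: X.M.a_ac)

lemma graded_smult_l_distr:
  assumes s: "s \<in> carrier S" "t \<in> carrier S" and x: "x \<in> carrier X"
  shows "act (s \<oplus>\<^bsub>S\<^esub> t) x = act s x \<oplus>\<^bsub>X\<^esub> act t x"
proof -
  have "finsum X (\<lambda>i. a i (snd (s \<oplus>\<^bsub>S\<^esub> t) i) x) {1..n} =
      finsum X (\<lambda>i. a i (snd s i) x \<oplus>\<^bsub>X\<^esub> a i (snd t i) x) {1..n}"
    by (rule X.M.finsum_cong'[OF refl])
      (use s x in \<open>auto simp: act_add_left act_closed S_snd simp del: atLeastAtMost_iff\<close>)
  also have "\<dots> = finsum X (\<lambda>i. a i (snd s i) x) {1..n} \<oplus>\<^bsub>X\<^esub> finsum X (\<lambda>i. a i (snd t i) x) {1..n}"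
    using s x by (intro X.M.finsum_addf Pi_I act_closed S_snd)
  finally show ?thesis
    using s x by (simp add: graded_smult_def X.smult_l_distr S_fst add_interchange
        X.smult_closed sum_closed)
qed

lemma graded_smult_r_distr:
  assumes s: "s \<in> carrier S" and x: "x \<in> carrier X" "y \<in> carrier X"
  shows "act s (x \<oplus>\<^bsub>X\<^esub> y) = act s x \<oplus>\<^bsub>X\<^esub> act s y"
proof -
  have "finsum X (\<lambda>i. a i (snd s i) (x \<oplus>\<^bsub>X\<^esub> y)) {1..n} =
      finsum X (\<lambda>i. a i (snd s i) x \<oplus>\<^bsub>X\<^esub> a i (snd s i) y) {1..n}"
    by (rule X.M.finsum_cong'[OF refl])
      (use s x in \<open>auto simp: act_add_right act_closed S_snd simp del: atLeastAtMost_iff\<close>)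
  also have "\<dots> = finsum X (\<lambda>i. a i (snd s i) x) {1..n} \<oplus>\<^bsub>X\<^esub> finsum X (\<lambda>i. a i (snd s i) y) {1..n}"
    using s x by (intro X.M.finsum_addf Pi_I act_closed S_snd)
  finally show ?thesis
    using s x by (simp add: graded_smult_def X.smult_r_distr S_fst add_interchange
        X.smult_closed sum_closed)
qed

lemma graded_smult_one:
  assumes "x \<in> carrier X"
  shows "act \<one>\<^bsub>S\<^esub> x = x"
proof -
  have "finsum X (\<lambda>i. a i (snd \<one>\<^bsub>S\<^esub> i) x) {1..n} = \<zero>\<^bsub>X\<^esub>"
    by (rule X.M.add.finprod_one_eqI) (use assms act_zero in \<open>simp del: atLeastAtMost_iff\<close>)
  with assms show ?thesis by (simp add: graded_smult_def X.smult_one)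
qed

lemma act_finsum_left:
  assumes "i \<in> {1..n}" "x \<in> carrier X" "finite A" "\<And>j. j \<in> A \<Longrightarrow> f j \<in> carrier (M i)"
  shows "a i (finsum (M i) f A) x = finsum X (\<lambda>j. a i (f j) x) A"
  by (rule additive_finsum[OF abelian_group_M X.M.abelian_group_axioms, where h = "\<lambda>m. a i m x"])
    (use assms in \<open>auto simp: act_closed act_add_left\<close>)

lemma act_finsum_right:
  assumes "i \<in> {1..n}" "m \<in> carrier (M i)" "finite A" "\<And>j. j \<in> A \<Longrightarrow> f j \<in> carrier X"
  shows "a i m (finsum X f A) = finsum X (\<lambda>j. a i m (f j)) A"
  by (rule additive_finsum[OF X.M.abelian_group_axioms X.M.abelian_group_axioms])
    (use assms in \<open>auto simp: act_closed act_add_right\<close>)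

lemma smult_finsum_right:
  assumes "r \<in> carrier R" "finite A" "\<And>j. j \<in> A \<Longrightarrow> f j \<in> carrier X"
  shows "r \<odot>\<^bsub>X\<^esub> finsum X f A = finsum X (\<lambda>j. r \<odot>\<^bsub>X\<^esub> f j) A"
  by (rule additive_finsum[OF X.M.abelian_group_axioms X.M.abelian_group_axioms])
    (use assms in \<open>auto simp: X.smult_closed X.smult_r_distr\<close>)

text \<open>Both sides expand into a scalar term, two mixed sums and a double sum over positive
  degrees. The double sums agree by \<open>finsum_convolution\<close>: the ring product has no
  component above degree \<open>n\<close>, and \<open>act_act\<close> annihilates those pairs in the
  iterated action.\<close>

lemma graded_smult_assoc:
  assumes s: "s \<in> carrier S" and t: "t \<in> carrier S" and x: "x \<in> carrier X"
  shows "act (s \<otimes>\<^bsub>S\<^esub> t) x = act s (act t x)"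
proof -
  note st = S_fst[OF s] S_fst[OF t] S_snd[OF s] S_snd[OF t]
  define c where "c i j = a (i + j) (mul i j (snd s i) (snd t j)) x" for i j
  have c: "c i j \<in> carrier X" if "1 \<le> i" "1 \<le> j" "i + j \<le> n" for i j
    unfolding c_def using that by (intro act_closed mul_closed st x) auto
  \<comment> \<open>\<open>P\<close> and \<open>Q\<close> collect the mixed terms, with the degree
    zero part taken from \<open>s\<close> and from \<open>t\<close> respectively. \<open>U\<close>
    and \<open>V\<close> contain the products of positive degrees, grouped by total degree as in the
    ring and by pairs of degrees as in the iterated action.\<close>
  define P where "P = finsum X (\<lambda>k. fst s \<odot>\<^bsub>X\<^esub> a k (snd t k) x) {1..n}"
  define Q where "Q = finsum X (\<lambda>k. a k (snd s k) (fst t \<odot>\<^bsub>X\<^esub> x)) {1..n}"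
  define U where "U = finsum X (\<lambda>k. finsum X (\<lambda>i. c i (k - i)) {1..<k}) {1..n}"
  define V where "V = finsum X (\<lambda>i. finsum X (\<lambda>j. if i + j \<le> n then c i j else \<zero>\<^bsub>X\<^esub>) {1..n}) {1..n}"
  have cl: "P \<in> carrier X" "Q \<in> carrier X" "U \<in> carrier X"
    unfolding P_def Q_def U_def
    by (auto intro!: X.M.finsum_closed Pi_I X.smult_closed act_closed st x c)
  have UV: "U = V"
    unfolding U_def V_def by (rule X.M.finsum_convolution[OF c])
  \<comment> \<open>In the last summand \<open>act_balanced\<close> moves the scalar
    \<open>fst t\<close> from the ring element over to \<open>x\<close>, which matches it with
    \<open>Q\<close>.\<close>
  have k: "a k (snd (s \<otimes>\<^bsub>S\<^esub> t) k) x =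
      fst s \<odot>\<^bsub>X\<^esub> a k (snd t k) x \<oplus>\<^bsub>X\<^esub> finsum X (\<lambda>i. c i (k - i)) {1..<k}
        \<oplus>\<^bsub>X\<^esub> a k (snd s k) (fst t \<odot>\<^bsub>X\<^esub> x)" if k: "k \<in> {1..n}" for k
  proof -
    have "a k (finsum (M k) (\<lambda>i. mul i (k - i) (snd s i) (snd t (k - i))) {1..<k}) x =
        finsum X (\<lambda>i. a k (mul i (k - i) (snd s i) (snd t (k - i))) x) {1..<k}"
      using k by (intro act_finsum_left x) (auto intro!: convolution_term_closed s t)
    also have "\<dots> = finsum X (\<lambda>i. c i (k - i)) {1..<k}"
      unfolding c_def using k
      by (intro X.M.finsum_cong') (auto intro!: act_closed convolution_term_closed s t x)
    finally show ?thesis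
      using k by (simp add: snd_mult act_add_left M_rules M_add_rules(1) st act_smult act_balanced x
          convolution_closed[OF _ s t] del: atLeastAtMost_iff)
  qed
  have "finsum X (\<lambda>k. a k (snd (s \<otimes>\<^bsub>S\<^esub> t) k) x) {1..n} = finsum X (\<lambda>k.
      fst s \<odot>\<^bsub>X\<^esub> a k (snd t k) x \<oplus>\<^bsub>X\<^esub> finsum X (\<lambda>i. c i (k - i)) {1..<k}
        \<oplus>\<^bsub>X\<^esub> a k (snd s k) (fst t \<odot>\<^bsub>X\<^esub> x)) {1..n}"
    by (rule X.M.finsum_cong'[OF refl _ k])
      (auto intro!: X.M.a_closed X.M.finsum_closed Pi_I X.smult_closed act_closed st x c)
  also have "\<dots> = P \<oplus>\<^bsub>X\<^esub> U \<oplus>\<^bsub>X\<^esub> Q"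
    unfolding P_def U_def Q_def
    by (subst X.M.finsum_addf,
        (auto intro!: X.M.a_closed X.M.finsum_closed Pi_I X.smult_closed act_closed st x c)[2])+ simp
  finally have lhs: "act (s \<otimes>\<^bsub>S\<^esub> t) x = (fst s \<otimes> fst t) \<odot>\<^bsub>X\<^esub> x \<oplus>\<^bsub>X\<^esub> (P \<oplus>\<^bsub>X\<^esub> U \<oplus>\<^bsub>X\<^esub> Q)"
    by (simp add: graded_smult_def)
  \<comment> \<open>The truncation enters here: \<open>act_act\<close> supplies the zeros for pairs
    of degrees with sum above \<open>n\<close>.\<close>
  have i: "a i (snd s i) (act t x) =
      a i (snd s i) (fst t \<odot>\<^bsub>X\<^esub> x) \<oplus>\<^bsub>X\<^esub> finsum X (\<lambda>j. if i + j \<le> n then c i j else \<zero>\<^bsub>X\<^esub>) {1..n}"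
    if i: "i \<in> {1..n}" for i
  proof -
    have "a i (snd s i) (finsum X (\<lambda>j. a j (snd t j) x) {1..n}) =
        finsum X (\<lambda>j. a i (snd s i) (a j (snd t j) x)) {1..n}"
      using i by (intro act_finsum_right) (auto intro!: act_closed st x)
    also have "\<dots> = finsum X (\<lambda>j. if i + j \<le> n then c i j else \<zero>\<^bsub>X\<^esub>) {1..n}"
      unfolding c_def using i
      by (intro X.M.finsum_cong') (auto simp: act_act st x intro!: act_closed mul_closed)
    finally show ?thesis
      using i by (simp add: graded_smult_def act_add_right st x X.smult_closed sum_closed[OF t]
          del: atLeastAtMost_iff)
  qed
  have "finsum X (\<lambda>i. a i (snd s i) (act t x)) {1..n} = finsum X (\<lambda>i.
      a i (snd s i) (fst t \<odot>\<^bsub>X\<^esub> x) \<oplus>\<^bsub>X\<^esub> finsum X (\<lambda>j. if i + j \<le> n then c i j else \<zero>\<^bsub>X\<^esub>) {1..n}) {1..n}"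
    by (rule X.M.finsum_cong'[OF refl _ i])
      (auto intro!: X.M.a_closed X.M.finsum_closed Pi_I X.smult_closed act_closed st x c)
  also have "\<dots> = Q \<oplus>\<^bsub>X\<^esub> V"
    unfolding Q_def V_def
    by (rule X.M.finsum_addf)
      (auto intro!: X.M.a_closed X.M.finsum_closed Pi_I X.smult_closed act_closed st x c)
  also have "fst s \<odot>\<^bsub>X\<^esub> act t x = fst s \<odot>\<^bsub>X\<^esub> (fst t \<odot>\<^bsub>X\<^esub> x) \<oplus>\<^bsub>X\<^esub> P"
  proof -
    have "fst s \<odot>\<^bsub>X\<^esub> finsum X (\<lambda>i. a i (snd t i) x) {1..n} = P"
      unfolding P_def by (intro smult_finsum_right) (auto intro!: act_closed st x)
    then show ?thesis
      by (simp add: graded_smult_def X.smult_r_distr st x X.smult_closed sum_closed[OF t])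
  qed
  ultimately have "act s (act t x) =
      fst s \<odot>\<^bsub>X\<^esub> (fst t \<odot>\<^bsub>X\<^esub> x) \<oplus>\<^bsub>X\<^esub> P \<oplus>\<^bsub>X\<^esub> (Q \<oplus>\<^bsub>X\<^esub> V)"
    unfolding graded_smult_def[of n X a s] by simp
  with lhs cl show ?thesis
    by (simp add: UV X.smult_assoc1 st x X.smult_closed X.M.a_ac)
qed

end


section \<open>The trivial extension as a ring\<close>

context trivial_extension
begin

section \<open>Homogeneous elements of the extension\<close>

definition const :: "'r \<Rightarrow> 'r \<times> (nat \<Rightarrow> 'm)"
  where "const r = (r, \<lambda>k\<in>{1..n}. \<zero>\<^bsub>M k\<^esub>)"

definition emb :: "nat \<Rightarrow> 'm \<Rightarrow> 'r \<times> (nat \<Rightarrow> 'm)"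
  where "emb i m = (\<zero>, \<lambda>k\<in>{1..n}. if k = i then m else \<zero>\<^bsub>M k\<^esub>)"

lemma const_proj [simp]:
  "fst (const r) = r"
  "k \<in> {1..n} \<Longrightarrow> snd (const r) k = \<zero>\<^bsub>M k\<^esub>"
  by (simp_all add: const_def)

lemma emb_proj [simp]:
  "fst (emb i m) = \<zero>"
  "k \<in> {1..n} \<Longrightarrow> snd (emb i m) k = (if k = i then m else \<zero>\<^bsub>M k\<^esub>)"
  by (simp_all add: emb_def)

lemma const_closed: "r \<in> carrier R \<Longrightarrow> const r \<in> carrier S"
  unfolding const_def by (intro S_carrierI M_add_rules(2))

lemma emb_closed: "m \<in> carrier (M i) \<Longrightarrow> emb i m \<in> carrier S"
  unfolding emb_def by (intro S_carrierI) (auto intro: M_add_rules(2) simp del: atLeastAtMost_iff)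

lemma one_eq_const: "\<one>\<^bsub>S\<^esub> = const \<one>"
  by (simp add: const_def trivial_extension_ring_def)

lemma const_add: "r \<in> carrier R \<Longrightarrow> r' \<in> carrier R \<Longrightarrow> const (r \<oplus> r') = const r \<oplus>\<^bsub>S\<^esub> const r'"
  by (intro S_eqI) (simp_all add: const_closed S_add_closed M_add_rules del: atLeastAtMost_iff)

lemma emb_add:
  "i \<in> {1..n} \<Longrightarrow> m \<in> carrier (M i) \<Longrightarrow> m' \<in> carrier (M i) \<Longrightarrow>
    emb i (m \<oplus>\<^bsub>M i\<^esub> m') = emb i m \<oplus>\<^bsub>S\<^esub> emb i m'"
  by (intro S_eqI) (auto simp: emb_closed S_add_closed M_add_rules simp del: atLeastAtMost_iff)

text \<open>In each coordinate exactly one summand survives. The decomposition is the reason why a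
  module over \<open>S\<close> is determined by the scalars \<open>const r\<close> and
  \<open>emb i m\<close>.\<close>

lemma S_decompose:
  assumes s: "s \<in> carrier S"
  shows "s = const (fst s) \<oplus>\<^bsub>S\<^esub> finsum S (\<lambda>i. emb i (snd s i)) {1..n}"
proof -
  interpret S: abelian_group S by (rule abelian_group_S)
  have c: "emb i (snd s i) \<in> carrier S" if "i \<in> {1..n}" for i
    using that s by (intro emb_closed S_snd)
  then have sum: "finsum S (\<lambda>i. emb i (snd s i)) {1..n} \<in> carrier S"
    by (intro S.finsum_closed) auto
  show ?thesis
  proof (rule S_eqI[OF s])
    show "const (fst s) \<oplus>\<^bsub>S\<^esub> finsum S (\<lambda>i. emb i (snd s i)) {1..n} \<in> carrier S"
      using s sum by (intro S_add_closed const_closed S_fst)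
    show "fst s = fst (const (fst s) \<oplus>\<^bsub>S\<^esub> finsum S (\<lambda>i. emb i (snd s i)) {1..n})"
      using S_fst[OF s] c by (simp add: fst_finsum del: atLeastAtMost_iff)
    fix k assume k: "k \<in> {1..n}"
    interpret Mk: abelian_group "M k" using k by (rule abelian_group_M)
    have "finsum (M k) (\<lambda>i. snd (emb i (snd s i)) k) {1..n} =
        finsum (M k) (\<lambda>i. if k = i then snd s i else \<zero>\<^bsub>M k\<^esub>) {1..n}"
      using k s by (intro Mk.finsum_cong') (auto simp: S_snd)
    also have "\<dots> = finsum (M k) (\<lambda>i. if k = i then snd s k else \<zero>\<^bsub>M k\<^esub>) {1..n}"
      using k s by (intro Mk.finsum_cong') (auto simp: S_snd)
    also have "\<dots> = snd s k"
      using k s by (intro Mk.finsum_singleton) (auto simp: S_snd)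
    finally show "snd s k = snd (const (fst s) \<oplus>\<^bsub>S\<^esub> finsum S (\<lambda>i. emb i (snd s i)) {1..n}) k"
      using k s c by (simp add: snd_finsum S_snd del: atLeastAtMost_iff)
  qed
qed

text \<open>The restriction of scalars of \<open>S\<close> to \<open>R\<close>, written
  componentwise so that it is available before the multiplication of \<open>S\<close> is known to
  obey any law.\<close>

definition self_module :: "('r, 'r \<times> (nat \<Rightarrow> 'm)) module"
  where "self_module =
    \<lparr>carrier = carrier S, monoid.mult = undefined, monoid.one = undefined,
     ring.zero = \<zero>\<^bsub>S\<^esub>, ring.add = (\<lambda>s t. s \<oplus>\<^bsub>S\<^esub> t),
     smult = (\<lambda>r s. (r \<otimes> fst s, \<lambda>k\<in>{1..n}. r \<odot>\<^bsub>M k\<^esub> snd s k))\<rparr>"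

text \<open>Left multiplication by \<open>emb i m\<close>, which raises degrees by \<open>i\<close>.
  Degree \<open>k = i\<close> is separate because the factor of degree zero lies in \<open>R\<close>
  and is met through the right action.\<close>

definition self_act :: "nat \<Rightarrow> 'm \<Rightarrow> 'r \<times> (nat \<Rightarrow> 'm) \<Rightarrow> 'r \<times> (nat \<Rightarrow> 'm)"
  where "self_act i m s = (\<zero>, \<lambda>k\<in>{1..n}.
    if k < i then \<zero>\<^bsub>M k\<^esub> else if k = i then m \<star>\<^bsub>M k\<^esub> fst s else mul i (k - i) m (snd s (k - i)))"

lemma self_module_simps [simp]:
  "carrier self_module = carrier S"
  "\<zero>\<^bsub>self_module\<^esub> = \<zero>\<^bsub>S\<^esub>"
  "s \<oplus>\<^bsub>self_module\<^esub> t = s \<oplus>\<^bsub>S\<^esub> t"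
  "fst (r \<odot>\<^bsub>self_module\<^esub> s) = r \<otimes> fst s"
  "k \<in> {1..n} \<Longrightarrow> snd (r \<odot>\<^bsub>self_module\<^esub> s) k = r \<odot>\<^bsub>M k\<^esub> snd s k"
  by (simp_all add: self_module_def)

lemma self_act_proj [simp]:
  "fst (self_act i m s) = \<zero>"
  "k \<in> {1..n} \<Longrightarrow> snd (self_act i m s) k = (if k < i then \<zero>\<^bsub>M k\<^esub>
    else if k = i then m \<star>\<^bsub>M k\<^esub> fst s else mul i (k - i) m (snd s (k - i)))"
  by (simp_all add: self_act_def)

lemma self_smult_closed: "r \<in> carrier R \<Longrightarrow> s \<in> carrier S \<Longrightarrow> r \<odot>\<^bsub>self_module\<^esub> s \<in> carrier S"
  by (auto simp: self_module_def S_fst S_snd M_rules intro!: S_carrierI simp del: atLeastAtMost_iff)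

lemma left_module_self: "left_module R self_module"
proof (intro left_module.intro left_module_axioms.intro)
  show "abelian_group self_module"
    using abelian_groupE[OF abelian_group_S] by (intro abelian_groupI) simp_all
qed (rule ring_R | (intro S_eqI)?; simp add: self_smult_closed S_add_closed S_fst S_snd M_rules
      R.l_distr R.r_distr R.m_assoc del: atLeastAtMost_iff)+

lemma diff_in_range: "k \<in> {1..n} \<Longrightarrow> \<not> k < i \<Longrightarrow> k \<noteq> i \<Longrightarrow> k - i \<in> {1..n}"
  by auto

text \<open>The product laws indexed by the target degree \<open>k\<close> instead of the degree of
  the second factor, as needed for comparisons of components.\<close>

lemma mul_rules_diff:
  assumes "i \<in> {1..n}" "k \<in> {1..n}" "\<not> k < i" "k \<noteq> i"
  shows "x \<in> carrier (M i) \<Longrightarrow> y \<in> carrier (M (k - i)) \<Longrightarrow> mul i (k - i) x y \<in> carrier (M k)"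
    and "x \<in> carrier (M i) \<Longrightarrow> x' \<in> carrier (M i) \<Longrightarrow> y \<in> carrier (M (k - i)) \<Longrightarrow>
      mul i (k - i) (x \<oplus>\<^bsub>M i\<^esub> x') y = mul i (k - i) x y \<oplus>\<^bsub>M k\<^esub> mul i (k - i) x' y"
    and "x \<in> carrier (M i) \<Longrightarrow> y \<in> carrier (M (k - i)) \<Longrightarrow> y' \<in> carrier (M (k - i)) \<Longrightarrow>
      mul i (k - i) x (y \<oplus>\<^bsub>M (k - i)\<^esub> y') = mul i (k - i) x y \<oplus>\<^bsub>M k\<^esub> mul i (k - i) x y'"
    and "r \<in> carrier R \<Longrightarrow> x \<in> carrier (M i) \<Longrightarrow> y \<in> carrier (M (k - i)) \<Longrightarrow>
      mul i (k - i) (r \<odot>\<^bsub>M i\<^esub> x) y = r \<odot>\<^bsub>M k\<^esub> mul i (k - i) x y"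
    and "r \<in> carrier R \<Longrightarrow> x \<in> carrier (M i) \<Longrightarrow> y \<in> carrier (M (k - i)) \<Longrightarrow>
      mul i (k - i) (x \<star>\<^bsub>M i\<^esub> r) y = mul i (k - i) x (r \<odot>\<^bsub>M (k - i)\<^esub> y)"
    and "x \<in> carrier (M i) \<Longrightarrow> mul i (k - i) x \<zero>\<^bsub>M (k - i)\<^esub> = \<zero>\<^bsub>M k\<^esub>"
  using mul_rules[of i "k - i"] mul_zero_right[of i "k - i"] assms by auto

lemma self_act_closed:
  "i \<in> {1..n} \<Longrightarrow> m \<in> carrier (M i) \<Longrightarrow> s \<in> carrier S \<Longrightarrow> self_act i m s \<in> carrier S"
  unfolding self_act_def
  by (intro S_carrierI)
    (simp_all add: S_fst S_snd M_rules M_add_rules mul_rules_diff diff_in_range del: atLeastAtMost_iff)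

text \<open>Compared degree by degree, the axioms reduce to the bimodule laws and to linearity and
  associativity of the products.\<close>

lemma graded_action_self: "graded_action n R M \<Phi> self_module self_act"
proof (intro graded_action.intro graded_action_axioms.intro left_module_self)
  show "trivial_extension n R M \<Phi>" by unfold_locales
next
  fix i j m m' s
  assume i: "i \<in> {1..n}" and j: "j \<in> {1..n}" and m: "m \<in> carrier (M i)" "m' \<in> carrier (M j)"
    and "s \<in> carrier self_module"
  then have s: "s \<in> carrier S" by simp
  have ij: "i + j \<in> {1..n}" "mul i j m m' \<in> carrier (M (i + j))" if "i + j \<le> n"
    using that i j m by (auto intro: mul_closed)
  show "self_act i m (self_act j m' s) =
      (if i + j \<le> n then self_act (i + j) (mul i j m m') s else \<zero>\<^bsub>self_module\<^esub>)" (is "?l = ?r")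
  proof (rule S_eqI)
    show "?l \<in> carrier S" using i j m s by (intro self_act_closed)
    show "?r \<in> carrier S" using ij s by (auto intro!: self_act_closed S_zero_closed)
    show "fst ?l = fst ?r" by simp
    fix k assume k: "k \<in> {1..n}"
    \<comment> \<open>Below degree \<open>i + j\<close> both sides vanish: the inner result has no
      component of degree less than \<open>j\<close>. At \<open>i + j\<close> the products commute
      with the right action by \<open>fst s\<close>, and above it \<open>mul_assoc\<close> applies.
      For \<open>i + j > n\<close> only the first three cases can occur, because \<open>k\<close> is
      at most \<open>n\<close>.\<close>
    consider "k < i" | "k = i" | "i < k" "k < i + j" | "k = i + j" | "k > i + j" by linarith
    then show "snd ?l k = snd ?r k"
    proof cases
      case 1
      then show ?thesis using k by (simp del: atLeastAtMost_iff)
    next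
      case 2
      then show ?thesis using k j m by (simp add: M_zero_rules)
    next
      case 3
      then have "k - i \<in> {1..n}" "k - i < j" using k by auto
      then show ?thesis using k i 3 m by (simp add: mul_rules_diff del: atLeastAtMost_iff)
    next
      case 4
      then show ?thesis using k i j m s by (simp add: mul_rsmult_right S_fst)
    next
      case 5
      then have *: "k - i \<in> {1..n}" "k - i > j" "k - i - j = k - (i + j)" "k - (i + j) \<in> {1..n}"
        using k by auto
      have "mul (i + j) (k - (i + j)) (mul i j m m') (snd s (k - (i + j))) =
          mul i (j + (k - (i + j))) m (mul j (k - (i + j)) m' (snd s (k - (i + j))))"
        using i j k m s 5 * by (intro mul_assoc S_snd) auto
      moreover have "j + (k - (i + j)) = k - i" "i + j \<le> n" using 5 k by auto
      ultimately show ?thesis using k i 5 * by (simp del: atLeastAtMost_iff)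
    qed
  qed
qed ((intro S_eqI)?; auto simp: self_act_closed self_smult_closed S_add_closed S_fst S_snd M_rules M_add_rules
      M_zero_rules mul_rules_diff diff_in_range simp del: atLeastAtMost_iff)+

end

context graded_action
begin

lemma graded_smult_const: "r \<in> carrier R \<Longrightarrow> x \<in> carrier X \<Longrightarrow> act (const r) x = r \<odot>\<^bsub>X\<^esub> x"
proof -
  assume *: "r \<in> carrier R" "x \<in> carrier X"
  have "finsum X (\<lambda>i. a i (snd (const r) i) x) {1..n} = \<zero>\<^bsub>X\<^esub>"
    by (rule X.M.add.finprod_one_eqI) (use * act_zero in \<open>simp del: atLeastAtMost_iff\<close>)
  with * show ?thesis by (simp add: graded_smult_def X.smult_closed)
qed

text \<open>Homogeneous scalars give back the maps from which the action was assembled; all other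
  summands act by zero. This makes the passage to \<open>S\<close>-modules reversible.\<close>

lemma graded_smult_emb:
  assumes "i \<in> {1..n}" "m \<in> carrier (M i)" "x \<in> carrier X"
  shows "act (emb i m) x = a i m x"
proof -
  have "finsum X (\<lambda>k. a k (snd (emb i m) k) x) {1..n} =
      finsum X (\<lambda>k. if i = k then a i m x else \<zero>\<^bsub>X\<^esub>) {1..n}"
    using assms by (intro X.M.finsum_cong') (auto simp: act_zero act_closed)
  also have "\<dots> = a i m x"
    using assms by (intro X.M.finsum_singleton) (auto simp: act_closed)
  finally show ?thesis
    using assms by (simp add: graded_smult_def X.smult_l_zero act_closed)
qed

end

context trivial_extension
begin

text \<open>The ring multiplication is the action of the ring on itself, so that the ring axioms are
  instances of the module axioms for graded actions.\<close>

lemma graded_smult_self: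
  assumes s: "s \<in> carrier S" and t: "t \<in> carrier S"
  shows "graded_smult n self_module self_act s t = s \<otimes>\<^bsub>S\<^esub> t"
proof -
  interpret self: graded_action n R M \<Phi> self_module self_act by (rule graded_action_self)
  have c: "self_act i (snd s i) t \<in> carrier S" if "i \<in> {1..n}" for i
    using that s t by (intro self_act_closed S_snd)
  \<comment> \<open>The two records share their additive group, so the identity map carries one sum
    into the other.\<close>
  have "finsum self_module (\<lambda>i. self_act i (snd s i) t) {1..n} = finsum S (\<lambda>i. self_act i (snd s i) t) {1..n}"
    by (rule additive_finsum[OF self.X.M.abelian_group_axioms abelian_group_S, where h = "\<lambda>x. x"])
      (use c in simp_all)
  then have eq: "graded_smult n self_module self_act s t =
      fst s \<odot>\<^bsub>self_module\<^esub> t \<oplus>\<^bsub>S\<^esub> finsum S (\<lambda>i. self_act i (snd s i) t) {1..n}"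
    by (simp add: graded_smult_def)
  show ?thesis
  proof (rule S_eqI)
    show "graded_smult n self_module self_act s t \<in> carrier S"
      using self.graded_smult_closed[of s t] s t by simp
    show "s \<otimes>\<^bsub>S\<^esub> t \<in> carrier S" using s t by (rule S_mult_closed)
    show "fst (graded_smult n self_module self_act s t) = fst (s \<otimes>\<^bsub>S\<^esub> t)"
      using c S_fst[OF s] S_fst[OF t] by (simp add: eq fst_finsum del: atLeastAtMost_iff)
    fix k assume k: "k \<in> {1..n}"
    interpret Mk: abelian_group "M k" using k by (rule abelian_group_M)
    let ?f = "\<lambda>i. mul i (k - i) (snd s i) (snd t (k - i))"
    have f: "?f i \<in> carrier (M k)" if "i \<in> {1..<k}" for i
      using that k s t by (rule_tac convolution_term_closed)
    have sk: "snd s k \<star>\<^bsub>M k\<^esub> fst t \<in> carrier (M k)"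
      using k s t by (intro M_rules S_fst S_snd)
    have "snd (finsum S (\<lambda>i. self_act i (snd s i) t) {1..n}) k =
        finsum (M k) (\<lambda>i. if k < i then \<zero>\<^bsub>M k\<^esub> else if k = i then snd s i \<star>\<^bsub>M k\<^esub> fst t else ?f i) {1..n}"
      using k c by (simp add: snd_finsum del: atLeastAtMost_iff)
    \<comment> \<open>Terms with \<open>i > k\<close> vanish. The term \<open>i = k\<close> is the
      right action by \<open>fst t\<close>, and the terms with \<open>i < k\<close> form the
      convolution in the ring product.\<close>
    also have "\<dots> = finsum (M k) (\<lambda>i. if k = i then snd s k \<star>\<^bsub>M k\<^esub> fst t else ?f i) (insert k {1..<k})"
      using k f sk by (intro Mk.add.finprod_mono_neutral_cong_right) auto
    also have "\<dots> = snd s k \<star>\<^bsub>M k\<^esub> fst t \<oplus>\<^bsub>M k\<^esub>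
        finsum (M k) (\<lambda>i. if k = i then snd s k \<star>\<^bsub>M k\<^esub> fst t else ?f i) {1..<k}"
      using f sk by (subst Mk.finsum_insert) auto
    also have "finsum (M k) (\<lambda>i. if k = i then snd s k \<star>\<^bsub>M k\<^esub> fst t else ?f i) {1..<k} =
        finsum (M k) ?f {1..<k}"
      using f by (intro Mk.finsum_cong') auto
    finally show "snd (graded_smult n self_module self_act s t) k = snd (s \<otimes>\<^bsub>S\<^esub> t) k"
      using k sk convolution_closed[OF k s t] M_rules(1)[OF k S_fst[OF s] S_snd[OF t k]]
      by (simp add: eq snd_mult Mk.a_ac del: atLeastAtMost_iff)
  qed
qed

lemma ring_S: "ring S"
proof -
  interpret self: graded_action n R M \<Phi> self_module self_act by (rule graded_action_self)
  note mult = graded_smult_self[symmetric]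
  show ?thesis
  proof (rule ringI[OF abelian_group_S])
    show "monoid S"
    proof (rule monoidI)
      fix s assume s: "s \<in> carrier S"
      show "\<one>\<^bsub>S\<^esub> \<otimes>\<^bsub>S\<^esub> s = s"
        using s self.graded_smult_one[of s] by (simp add: mult S_one_closed)
      show "s \<otimes>\<^bsub>S\<^esub> \<one>\<^bsub>S\<^esub> = s"
      proof (rule S_eqI)
        fix k assume k: "k \<in> {1..n}"
        interpret Mk: abelian_group "M k" using k by (rule abelian_group_M)
        have "finsum (M k) (\<lambda>i. mul i (k - i) (snd s i) (snd \<one>\<^bsub>S\<^esub> (k - i))) {1..<k} = \<zero>\<^bsub>M k\<^esub>"
        proof (rule Mk.add.finprod_one_eqI)
          fix i assume "i \<in> {1..<k}"
          then have "i \<in> {1..n}" "\<not> k < i" "k \<noteq> i" using k by auto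
          then show "mul i (k - i) (snd s i) (snd \<one>\<^bsub>S\<^esub> (k - i)) = \<zero>\<^bsub>M k\<^esub>"
            using k s by (simp add: mul_rules_diff S_snd diff_in_range del: atLeastAtMost_iff)
        qed
        then show "snd (s \<otimes>\<^bsub>S\<^esub> \<one>\<^bsub>S\<^esub>) k = snd s k"
          using k s by (simp add: snd_mult M_zero_rules M_rules S_fst S_snd del: atLeastAtMost_iff)
      qed (use s in \<open>simp_all add: S_mult_closed S_one_closed S_fst\<close>)
    next
      fix s t u assume "s \<in> carrier S" "t \<in> carrier S" "u \<in> carrier S"
      then show "s \<otimes>\<^bsub>S\<^esub> t \<otimes>\<^bsub>S\<^esub> u = s \<otimes>\<^bsub>S\<^esub> (t \<otimes>\<^bsub>S\<^esub> u)"
        using self.graded_smult_assoc[of s t u] by (simp add: graded_smult_self S_mult_closed)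
    qed (simp_all add: S_mult_closed S_one_closed)
  next
    fix s t u assume "s \<in> carrier S" "t \<in> carrier S" "u \<in> carrier S"
    then show "(s \<oplus>\<^bsub>S\<^esub> t) \<otimes>\<^bsub>S\<^esub> u = s \<otimes>\<^bsub>S\<^esub> u \<oplus>\<^bsub>S\<^esub> t \<otimes>\<^bsub>S\<^esub> u"
      and "u \<otimes>\<^bsub>S\<^esub> (s \<oplus>\<^bsub>S\<^esub> t) = u \<otimes>\<^bsub>S\<^esub> s \<oplus>\<^bsub>S\<^esub> u \<otimes>\<^bsub>S\<^esub> t"
      using self.graded_smult_l_distr[of s t u] self.graded_smult_r_distr[of u s t]
      by (simp_all add: graded_smult_self S_add_closed)
  qed
qed

section \<open>The multiplication table of homogeneous elements\<close>

lemma const_mult: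
  assumes "r \<in> carrier R" "s \<in> carrier S"
  shows "const r \<otimes>\<^bsub>S\<^esub> s = r \<odot>\<^bsub>self_module\<^esub> s"
  using assms graded_action.graded_smult_const[OF graded_action_self, of r s]
  by (simp add: graded_smult_self const_closed)

lemma emb_mult:
  assumes "i \<in> {1..n}" "m \<in> carrier (M i)" "s \<in> carrier S"
  shows "emb i m \<otimes>\<^bsub>S\<^esub> s = self_act i m s"
  using assms graded_action.graded_smult_emb[OF graded_action_self, of i m s]
  by (simp add: graded_smult_self emb_closed)

lemma const_const: "r \<in> carrier R \<Longrightarrow> r' \<in> carrier R \<Longrightarrow> const r \<otimes>\<^bsub>S\<^esub> const r' = const (r \<otimes> r')"
  by (simp add: const_mult const_closed del: atLeastAtMost_iff, intro S_eqI)
    (simp_all add: const_closed self_smult_closed M_zero_rules del: atLeastAtMost_iff)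

lemma const_emb:
  "i \<in> {1..n} \<Longrightarrow> r \<in> carrier R \<Longrightarrow> m \<in> carrier (M i) \<Longrightarrow> const r \<otimes>\<^bsub>S\<^esub> emb i m = emb i (r \<odot>\<^bsub>M i\<^esub> m)"
  by (simp add: const_mult emb_closed del: atLeastAtMost_iff, intro S_eqI)
    (simp_all add: emb_closed self_smult_closed M_zero_rules M_rules del: atLeastAtMost_iff)

lemma emb_const:
  "i \<in> {1..n} \<Longrightarrow> r \<in> carrier R \<Longrightarrow> m \<in> carrier (M i) \<Longrightarrow> emb i m \<otimes>\<^bsub>S\<^esub> const r = emb i (m \<star>\<^bsub>M i\<^esub> r)"
  by (simp add: emb_mult const_closed del: atLeastAtMost_iff, intro S_eqI)
    (simp_all add: emb_closed const_closed self_act_closed M_rules mul_rules_diff diff_in_range del: atLeastAtMost_iff)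

text \<open>Since \<open>emb i m\<close> is the result of \<open>self_act i m\<close> on the unit,
  the product is \<open>act_act\<close> for the action of \<open>S\<close> on itself, evaluated at
  the unit.\<close>

lemma emb_emb:
  assumes "i \<in> {1..n}" "j \<in> {1..n}" "m \<in> carrier (M i)" "m' \<in> carrier (M j)"
  shows "emb i m \<otimes>\<^bsub>S\<^esub> emb j m' = (if i + j \<le> n then emb (i + j) (mul i j m m') else \<zero>\<^bsub>S\<^esub>)"
proof -
  interpret S: ring S by (rule ring_S)
  have e: "emb i m = self_act i m \<one>\<^bsub>S\<^esub>" if "i \<in> {1..n}" "m \<in> carrier (M i)" for i m
    using that emb_mult[of i m "\<one>\<^bsub>S\<^esub>"] by (simp add: emb_closed)
  have ij: "i + j \<in> {1..n}" "mul i j m m' \<in> carrier (M (i + j))" if "i + j \<le> n"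
    using that assms by (auto intro: mul_closed)
  have "emb i m \<otimes>\<^bsub>S\<^esub> emb j m' = self_act i m (self_act j m' \<one>\<^bsub>S\<^esub>)"
    using assms by (simp add: emb_mult emb_closed del: atLeastAtMost_iff flip: e)
  also have "\<dots> = (if i + j \<le> n then self_act (i + j) (mul i j m m') \<one>\<^bsub>S\<^esub> else \<zero>\<^bsub>S\<^esub>)"
    using graded_action.act_act[OF graded_action_self assms, of "\<one>\<^bsub>S\<^esub>"] by simp
  also have "\<dots> = (if i + j \<le> n then emb (i + j) (mul i j m m') else \<zero>\<^bsub>S\<^esub>)"
    using ij e by simp
  finally show ?thesis .
qed

end

section \<open>Isomorphism of categories\<close>

text \<open>Tailored to functors that act as the identity on arrows: what remains is a bijection on
  objects under which hom-sets, identities and composition literally coincide.\<close>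

lemma isomorphic_categoriesI:
  fixes C :: "('o, 'a) category" and D :: "('p, 'a) category"
  assumes D: "category D"
    and F: "\<And>X. X \<in> Obj C \<Longrightarrow> F X \<in> Obj D" and G: "\<And>Y. Y \<in> Obj D \<Longrightarrow> G Y \<in> Obj C"
    and GF: "\<And>X. X \<in> Obj C \<Longrightarrow> G (F X) = X" and FG: "\<And>Y. Y \<in> Obj D \<Longrightarrow> F (G Y) = Y"
    and Hom: "\<And>X Y. X \<in> Obj C \<Longrightarrow> Y \<in> Obj C \<Longrightarrow> Hom C X Y = Hom D (F X) (F Y)"
    and Ident: "\<And>X. X \<in> Obj C \<Longrightarrow> Ident C X = Ident D (F X)"
    and Comp: "\<And>X Y Z. X \<in> Obj C \<Longrightarrow> Y \<in> Obj C \<Longrightarrow> Z \<in> Obj C \<Longrightarrow>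
      Comp C X Y Z = Comp D (F X) (F Y) (F Z)"
  shows "isomorphic_categories C D"
proof -
  interpret D: category D by (rule D)
  \<comment> \<open>The category axioms are pulled back along \<open>F\<close>, so they have to be
    established for modules over a ring only.\<close>
  have C: "category C"
    by unfold_locales
      (simp_all add: F Hom Ident Comp D.Ident_Hom D.Comp_Hom D.Comp_Ident_right
        D.Comp_Ident_left D.Comp_assoc[OF F F F F])
  have "category_functor C D F (\<lambda>_ _ f. f)" "category_functor D C G (\<lambda>_ _ f. f)"
    by (intro category_functor.intro C D category_functor_axioms.intro;
        simp add: F G FG Hom Ident Comp)+
  with GF FG show ?thesis
    unfolding isomorphic_categories_def by blast
qed

lemma category_left_module_category: "category (left_module_category R)"
proof
  fix X Y Z f g
  assume "f \<in> Hom (left_module_category R) X Y" "g \<in> Hom (left_module_category R) Y Z"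
    "X \<in> Obj (left_module_category R)"
  then show "Comp (left_module_category R) X Y Z g f \<in> Hom (left_module_category R) X Z"
    using left_module.smult_closed[of R X] abelian_groupE(1)[of X]
    by (auto simp: left_module_category_def left_module_hom_def compose_def left_modules_def
        left_module_def Pi_iff)
next
  fix X assume "X \<in> Obj (left_module_category R)"
  then show "Ident (left_module_category R) X \<in> Hom (left_module_category R) X X"
    using left_module.smult_closed[of R X] abelian_groupE(1)[of X]
    by (auto simp: left_module_category_def left_module_hom_def left_modules_def left_module_def)
qed (auto simp: left_module_category_def left_module_hom_def intro: compose_Id Id_compose compose_assoc[symmetric])

section \<open>Graded actions over \<open>R\<close> and modules over the extension\<close>

context trivial_extension
begin

text \<open>The scalar action is cut off to \<open>undefined\<close> outside the carriers because
  \<open>graded_smult\<close> does not satisfy the normalization demanded of objects. Addition is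
  taken over from a module that is normalized already.\<close>

definition extension_module ::
  "('r, 'x) module \<Rightarrow> (nat \<Rightarrow> 'm \<Rightarrow> 'x \<Rightarrow> 'x) \<Rightarrow> ('r \<times> (nat \<Rightarrow> 'm), 'x) module"
  where "extension_module X a =
    \<lparr>carrier = carrier X, monoid.mult = undefined, monoid.one = undefined,
     ring.zero = \<zero>\<^bsub>X\<^esub>, ring.add = (\<lambda>x y. x \<oplus>\<^bsub>X\<^esub> y),
     smult = (\<lambda>s x. if s \<in> carrier S \<and> x \<in> carrier X then graded_smult n X a s x else undefined)\<rparr>"

lemma extension_module_simps [simp]:
  "carrier (extension_module X a) = carrier X"
  "\<zero>\<^bsub>extension_module X a\<^esub> = \<zero>\<^bsub>X\<^esub>"
  "x \<oplus>\<^bsub>extension_module X a\<^esub> y = x \<oplus>\<^bsub>X\<^esub> y"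
  "s \<in> carrier S \<Longrightarrow> x \<in> carrier X \<Longrightarrow> s \<odot>\<^bsub>extension_module X a\<^esub> x = graded_smult n X a s x"
  by (simp_all add: extension_module_def)

lemma extension_module_left_modules:
  assumes X: "X \<in> left_modules R" and a: "graded_action n R M \<Phi> X a"
  shows "extension_module X a \<in> left_modules S"
proof -
  interpret graded_action n R M \<Phi> X a by (rule a)
  have "left_module S (extension_module X a)"
  proof (intro left_module.intro left_module_axioms.intro ring_S)
    show "abelian_group (extension_module X a)"
      using abelian_groupE[OF X.M.abelian_group_axioms] by (intro abelian_groupI) simp_all
  qed (simp_all add: graded_smult_closed graded_smult_l_distr graded_smult_r_distr
      graded_smult_assoc graded_smult_one S_closed S_one_closed)
  then show ?thesis
    using X by (auto simp: left_modules_def normalized_module_def extension_module_def)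
qed

definition restrict_module :: "('r \<times> (nat \<Rightarrow> 'm), 'x) module \<Rightarrow> ('r, 'x) module"
  where "restrict_module Y =
    \<lparr>carrier = carrier Y, monoid.mult = undefined, monoid.one = undefined,
     ring.zero = \<zero>\<^bsub>Y\<^esub>, ring.add = (\<lambda>x y. x \<oplus>\<^bsub>Y\<^esub> y),
     smult = (\<lambda>r x. if r \<in> carrier R \<and> x \<in> carrier Y then const r \<odot>\<^bsub>Y\<^esub> x else undefined)\<rparr>"

abbreviation emb_act :: "('r \<times> (nat \<Rightarrow> 'm), 'x) module \<Rightarrow> nat \<Rightarrow> 'm \<Rightarrow> 'x \<Rightarrow> 'x"
  where "emb_act Y i m x \<equiv> emb i m \<odot>\<^bsub>Y\<^esub> x"

lemma restrict_module_simps [simp]: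
  "carrier (restrict_module Y) = carrier Y"
  "\<zero>\<^bsub>restrict_module Y\<^esub> = \<zero>\<^bsub>Y\<^esub>"
  "x \<oplus>\<^bsub>restrict_module Y\<^esub> y = x \<oplus>\<^bsub>Y\<^esub> y"
  "r \<in> carrier R \<Longrightarrow> x \<in> carrier Y \<Longrightarrow> r \<odot>\<^bsub>restrict_module Y\<^esub> x = const r \<odot>\<^bsub>Y\<^esub> x"
  by (simp_all add: restrict_module_def)

lemma restrict_module_left_modules:
  assumes "Y \<in> left_modules S"
  shows "restrict_module Y \<in> left_modules R"
proof -
  interpret Y: left_module S Y using assms by (simp add: left_modules_def)
  have "left_module R (restrict_module Y)"
  proof (intro left_module.intro left_module_axioms.intro ring_R)
    show "abelian_group (restrict_module Y)"
      using abelian_groupE[OF Y.M.abelian_group_axioms] by (intro abelian_groupI) simp_all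
  qed (simp_all add: const_closed Y.smult_closed Y.smult_r_distr Y.smult_one
      const_add Y.smult_l_distr Y.smult_assoc1 flip: one_eq_const const_const)
  then show ?thesis
    using assms by (auto simp: left_modules_def normalized_module_def restrict_module_def)
qed

text \<open>Each axiom is a module axiom of \<open>Y\<close> combined with an entry of the
  multiplication table. Products of homogeneous elements in degree above \<open>n\<close> are zero
  in \<open>S\<close> and hence act by zero.\<close>

lemma graded_action_restrict:
  assumes "Y \<in> left_modules S"
  shows "graded_action n R M \<Phi> (restrict_module Y) (emb_act Y)"
proof -
  interpret Y: left_module S Y using assms by (simp add: left_modules_def)
  have X: "left_module R (restrict_module Y)"
    using restrict_module_left_modules[OF assms] by (simp add: left_modules_def)
  show ?thesis
  proof (intro graded_action.intro graded_action_axioms.intro X)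
    show "trivial_extension n R M \<Phi>" by unfold_locales
  next
    fix i j m m' x
    assume "i \<in> {1..n}" "j \<in> {1..n}" "m \<in> carrier (M i)" "m' \<in> carrier (M j)"
      "x \<in> carrier (restrict_module Y)"
    then show "emb_act Y i m (emb_act Y j m' x) =
        (if i + j \<le> n then emb_act Y (i + j) (mul i j m m') x else \<zero>\<^bsub>restrict_module Y\<^esub>)"
      using emb_emb[of i j m m'] Y.smult_assoc1[of "emb i m" "emb j m'" x]
      by (auto simp: emb_closed Y.smult_l_zero split: if_splits simp del: atLeastAtMost_iff)
  qed (simp_all add: emb_closed const_closed Y.smult_closed emb_add Y.smult_l_distr
      Y.smult_r_distr Y.smult_assoc1 flip: const_emb emb_const del: atLeastAtMost_iff)
qed

text \<open>On the carriers this is \<open>graded_smult_const\<close>; elsewhere both scalar actions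
  are \<open>undefined\<close>, since \<open>X\<close> is normalized.\<close>

lemma restrict_extension:
  assumes X: "X \<in> left_modules R" and a: "graded_action n R M \<Phi> X a"
  shows "restrict_module (extension_module X a) = X"
proof -
  interpret graded_action n R M \<Phi> X a by (rule a)
  show ?thesis
    using X by (intro module.equality)
      (auto simp: restrict_module_def extension_module_def left_modules_def normalized_module_def
        graded_smult_const const_closed fun_eq_iff)
qed

text \<open>The action of a scalar is recovered from its homogeneous components by additivity.
  Agreement of \<open>a\<close> with the action of \<open>emb\<close> is asked on carriers only,
  which is what an action read off from tensor lifts provides.\<close>

lemma extension_restrict:
  assumes Y: "Y \<in> left_modules S"
    and a: "\<And>i m x. i \<in> {1..n} \<Longrightarrow> m \<in> carrier (M i) \<Longrightarrow> x \<in> carrier Y \<Longrightarrow> a i m x = emb i m \<odot>\<^bsub>Y\<^esub> x"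
  shows "extension_module (restrict_module Y) a = Y"
proof -
  interpret Y: left_module S Y using Y by (simp add: left_modules_def)
  interpret X: left_module R "restrict_module Y"
    using restrict_module_left_modules[OF Y] by (simp add: left_modules_def)
  have "graded_smult n (restrict_module Y) a s x = s \<odot>\<^bsub>Y\<^esub> x"
    if s: "s \<in> carrier S" and x: "x \<in> carrier Y" for s x
  proof -
    have e: "emb i (snd s i) \<in> carrier S" if "i \<in> {1..n}" for i
      using s that by (intro emb_closed S_snd)
    have "finsum (restrict_module Y) (\<lambda>i. a i (snd s i) x) {1..n} =
        finsum (restrict_module Y) (\<lambda>i. emb i (snd s i) \<odot>\<^bsub>Y\<^esub> x) {1..n}"
      using s x e by (intro X.M.finsum_cong')
        (auto simp: a S_snd Y.smult_closed simp del: atLeastAtMost_iff)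
    also have "\<dots> = finsum Y (\<lambda>i. emb i (snd s i) \<odot>\<^bsub>Y\<^esub> x) {1..n}"
      by (rule additive_finsum[OF X.M.abelian_group_axioms Y.M.abelian_group_axioms, where h = "\<lambda>x. x"])
        (use e x in \<open>simp_all add: Y.smult_closed\<close>)
    also have "\<dots> = finsum S (\<lambda>i. emb i (snd s i)) {1..n} \<odot>\<^bsub>Y\<^esub> x"
      by (rule additive_finsum[OF abelian_group_S Y.M.abelian_group_axioms, where h = "\<lambda>s. s \<odot>\<^bsub>Y\<^esub> x", symmetric])
        (use e x in \<open>simp_all add: Y.smult_closed Y.smult_l_distr\<close>)
    finally have sum: "finsum (restrict_module Y) (\<lambda>i. a i (snd s i) x) {1..n} =
      finsum S (\<lambda>i. emb i (snd s i)) {1..n} \<odot>\<^bsub>Y\<^esub> x" .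
    have c: "finsum S (\<lambda>i. emb i (snd s i)) {1..n} \<in> carrier S"
      using e by (intro Y.R.finsum_closed) auto
    have "s \<odot>\<^bsub>Y\<^esub> x = const (fst s) \<odot>\<^bsub>Y\<^esub> x \<oplus>\<^bsub>Y\<^esub> finsum S (\<lambda>i. emb i (snd s i)) {1..n} \<odot>\<^bsub>Y\<^esub> x"
      using Y.smult_l_distr[OF const_closed[OF S_fst[OF s]] c x] S_decompose[OF s] by metis
    with s x show ?thesis by (simp add: graded_smult_def sum S_fst)
  qed
  then show ?thesis
    using Y by (intro module.equality)
      (auto simp: extension_module_def left_modules_def normalized_module_def fun_eq_iff)
qed

text \<open>One direction evaluates linearity over \<open>S\<close> at \<open>const r\<close> and
  \<open>emb i m\<close>; the other adds up the conditions over the homogeneous components of a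
  scalar.\<close>

lemma extension_hom_iff:
  assumes a: "graded_action n R M \<Phi> X a" and b: "graded_action n R M \<Phi> Y b"
  shows "\<gamma> \<in> left_module_hom S (extension_module X a) (extension_module Y b) \<longleftrightarrow>
    \<gamma> \<in> left_module_hom R X Y \<and>
    (\<forall>i\<in>{1..n}. \<forall>m\<in>carrier (M i). \<forall>x\<in>carrier X. \<gamma> (a i m x) = b i m (\<gamma> x))"
    (is "?l \<longleftrightarrow> ?r")
proof
  interpret X: graded_action n R M \<Phi> X a by (rule a)
  interpret Y: graded_action n R M \<Phi> Y b by (rule b)
  {
    assume ?l
    then have cl: "\<gamma> x \<in> carrier Y" and ad: "\<gamma> (x \<oplus>\<^bsub>X\<^esub> x') = \<gamma> x \<oplus>\<^bsub>Y\<^esub> \<gamma> x'"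
      and sm: "s \<in> carrier S \<Longrightarrow> \<gamma> (X.act s x) = Y.act s (\<gamma> x)"
      if "x \<in> carrier X" "x' \<in> carrier X" for s x x'
      using that by (auto simp: left_module_hom_def Pi_iff)
    have "\<gamma> (r \<odot>\<^bsub>X\<^esub> x) = r \<odot>\<^bsub>Y\<^esub> \<gamma> x" if "r \<in> carrier R" "x \<in> carrier X" for r x
      using sm[OF that(2,2) const_closed[OF that(1)]] that cl
      by (simp add: X.graded_smult_const Y.graded_smult_const)
    moreover have "\<gamma> (a i m x) = b i m (\<gamma> x)"
      if "i \<in> {1..n}" "m \<in> carrier (M i)" "x \<in> carrier X" for i m x
      using sm[OF that(3,3) emb_closed[OF that(2)]] that cl
      by (simp add: X.graded_smult_emb Y.graded_smult_emb del: atLeastAtMost_iff)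
    ultimately show ?r using cl ad by (auto simp: left_module_hom_def)
  }
  assume r: ?r
  then have cl: "x \<in> carrier X \<Longrightarrow> \<gamma> x \<in> carrier Y"
    and ad: "x \<in> carrier X \<Longrightarrow> x' \<in> carrier X \<Longrightarrow> \<gamma> (x \<oplus>\<^bsub>X\<^esub> x') = \<gamma> x \<oplus>\<^bsub>Y\<^esub> \<gamma> x'"
    and sm: "r \<in> carrier R \<Longrightarrow> x \<in> carrier X \<Longrightarrow> \<gamma> (r \<odot>\<^bsub>X\<^esub> x) = r \<odot>\<^bsub>Y\<^esub> \<gamma> x"
    and ac: "i \<in> {1..n} \<Longrightarrow> m \<in> carrier (M i) \<Longrightarrow> x \<in> carrier X \<Longrightarrow> \<gamma> (a i m x) = b i m (\<gamma> x)"
    for i m r x x'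
    by (auto simp: left_module_hom_def Pi_iff)
  have "\<gamma> (X.act s x) = Y.act s (\<gamma> x)" if s: "s \<in> carrier S" and x: "x \<in> carrier X" for s x
  proof -
    have "\<gamma> (finsum X (\<lambda>i. a i (snd s i) x) {1..n}) = finsum Y (\<lambda>i. \<gamma> (a i (snd s i) x)) {1..n}"
      using s x
      by (intro additive_finsum[OF X.X.M.abelian_group_axioms Y.X.M.abelian_group_axioms])
        (auto simp: cl ad X.act_closed S_snd simp del: atLeastAtMost_iff)
    also have "\<dots> = finsum Y (\<lambda>i. b i (snd s i) (\<gamma> x)) {1..n}"
      using s x by (intro Y.X.M.finsum_cong')
        (auto simp: cl ac Y.act_closed S_snd simp del: atLeastAtMost_iff)
    finally show ?thesis
      using s x by (simp add: graded_smult_def ad sm X.sum_closed X.X.smult_closed S_fst)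
  qed
  then show ?l using cl ad by (auto simp: left_module_hom_def)
qed

section \<open>Objects and morphisms of the trivial extension category in terms of elements\<close>

lemma tensor_product_M: "i \<in> {1..n} \<Longrightarrow> left_module R X \<Longrightarrow> tensor_product R (M i) X"
  by (intro tensor_product.intro bimodule_M)

lemma F_map:
  assumes "i \<in> {1..n}" "left_module R X" "left_module R Y" "g \<in> left_module_hom R X Y"
  shows F_map_hom: "F_map R M i X Y g \<in> hom (tensor_group R (M i) X) (tensor_group R (M i) Y)"
    and F_map_elt: "m \<in> carrier (M i) \<Longrightarrow> x \<in> carrier X \<Longrightarrow>
      F_map R M i X Y g (tensor_elt R (M i) X m x) = tensor_elt R (M i) Y m (g x)"
proof -
  note t = tensor_map[OF tensor_product_M[OF assms(1,2)] tensor_product_M[OF assms(1,3)] _ _ _ assms(4), of id]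
  show "F_map R M i X Y g \<in> hom (tensor_group R (M i) X) (tensor_group R (M i) Y)"
    unfolding F_map_def by (rule t(1)) simp_all
  show "m \<in> carrier (M i) \<Longrightarrow> x \<in> carrier X \<Longrightarrow>
      F_map R M i X Y g (tensor_elt R (M i) X m x) = tensor_elt R (M i) Y m (g x)"
    unfolding F_map_def using t(2) by simp
qed

text \<open>The value on iterated pure tensors is what connects the compatibility condition with
  \<open>act_act\<close>; being a homomorphism makes these values decisive.\<close>

lemma phi_tensor:
  assumes i: "i \<in> {1..n}" and j: "j \<in> {1..n}" and ij: "i + j \<le> n" and X: "left_module R X"
  shows phi_tensor_hom: "phi_tensor R M \<Phi> i j X \<in>
      hom (tensor_group R (M i) (tensor R (M j) X)) (tensor_group R (M (i + j)) X)"
    and phi_tensor_elt: "m \<in> carrier (M i) \<Longrightarrow> m' \<in> carrier (M j) \<Longrightarrow> x \<in> carrier X \<Longrightarrow>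
      phi_tensor R M \<Phi> i j X (tensor_elt R (M i) (tensor R (M j) X) m (tensor_elt R (M j) X m' x)) =
      tensor_elt R (M (i + j)) X (mul i j m m') x"
proof -
  interpret A: tensor_associativity R "M i" "M j" X
    using i j X by (intro tensor_associativity.intro bimodule_M)
  have "\<Phi> i j \<in> bimodule_hom R (bimodule_tensor R (M i) (M j)) (M (i + j))"
    using products i j ij by (auto simp: associative_products_def)
  then have \<Phi>: "t \<in> carrier A.AB.T \<Longrightarrow> \<Phi> i j t \<in> carrier (M (i + j))"
    "s \<in> carrier A.AB.T \<Longrightarrow> t \<in> carrier A.AB.T \<Longrightarrow> \<Phi> i j (s \<otimes>\<^bsub>A.AB.T\<^esub> t) = \<Phi> i j s \<oplus>\<^bsub>M (i + j)\<^esub> \<Phi> i j t"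
    "r \<in> carrier R \<Longrightarrow> t \<in> carrier A.AB.T \<Longrightarrow> \<Phi> i j (t \<star>\<^bsub>A.AB.AB\<^esub> r) = \<Phi> i j t \<star>\<^bsub>M (i + j)\<^esub> r" for r s t
    by (auto simp: bimodule_hom_def left_module_hom_def)
  have "tensor_product R (M (i + j)) X" using i ij X by (intro tensor_product_M) auto
  moreover have "id \<in> left_module_hom R X X" by (simp add: left_module_hom_def)
  ultimately have t: "tensor_map R A.AB.AB X (M (i + j)) X (\<Phi> i j) id \<in>
      hom A.AB_X.T (tensor_group R (M (i + j)) X)"
    "t \<in> carrier A.AB.T \<Longrightarrow> x \<in> carrier X \<Longrightarrow>
      tensor_map R A.AB.AB X (M (i + j)) X (\<Phi> i j) id (A.AB_X.elt t x) =
      tensor_elt R (M (i + j)) X (\<Phi> i j t) x" for t x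
    using tensor_map[OF A.AB_X.tensor_product_axioms, of "M (i + j)" X "\<Phi> i j" id] by (simp_all add: \<Phi>)
  show "phi_tensor R M \<Phi> i j X \<in>
      hom (tensor_group R (M i) (tensor R (M j) X)) (tensor_group R (M (i + j)) X)"
    using hom_compose[OF A.tensor_assoc_hom t(1)] by (simp add: phi_tensor_def[abs_def] comp_def)
  show "m \<in> carrier (M i) \<Longrightarrow> m' \<in> carrier (M j) \<Longrightarrow> x \<in> carrier X \<Longrightarrow>
      phi_tensor R M \<Phi> i j X (tensor_elt R (M i) (tensor R (M j) X) m (tensor_elt R (M j) X m' x)) =
      tensor_elt R (M (i + j)) X (mul i j m m') x"
    by (simp add: phi_tensor_def A.tensor_assoc_elt t(2) A.AB.elt_closed phi_prod_def)
qed

abbreviation obj_act :: "('r, 'x) module \<Rightarrow> (nat \<Rightarrow> ('m, 'x) tens \<Rightarrow> 'x) \<Rightarrow> nat \<Rightarrow> 'm \<Rightarrow> 'x \<Rightarrow> 'x"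
  where "obj_act X f i m x \<equiv> f i (tensor_elt R (M i) X m x)"

lemma trivial_extension_objectsD:
  assumes "(X, f) \<in> trivial_extension_objects n R M \<Phi>"
  shows "X \<in> left_modules R" "left_module R X"
    and "f \<in> extensional {1..n}"
    and "i \<in> {1..n} \<Longrightarrow> f i \<in> left_module_hom R (tensor R (M i) X) X"
    and "i \<in> {1..n} \<Longrightarrow> f i \<in> extensional (carrier (tensor R (M i) X))"
    and "\<lbrakk>i \<in> {1..n}; j \<in> {1..n}; t \<in> carrier (tensor R (M i) (tensor R (M j) X))\<rbrakk> \<Longrightarrow>
      f i (F_map R M i (tensor R (M j) X) X (f j) t) =
      (if i + j \<le> n then f (i + j) (phi_tensor R M \<Phi> i j X t) else \<zero>\<^bsub>X\<^esub>)"
  using assms by (auto simp: trivial_extension_objects_def left_modules_def PiE_iff)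

text \<open>The compatibility condition, evaluated at the tensor of \<open>m\<close> with the tensor
  of \<open>m'\<close> and \<open>x\<close>, is \<open>act_act\<close>. The other axioms combine the
  tensor relations with linearity of \<open>f i\<close>.\<close>

lemma graded_action_object:
  assumes obj: "(X, f) \<in> trivial_extension_objects n R M \<Phi>"
  shows "graded_action n R M \<Phi> X (obj_act X f)"
proof -
  note D = trivial_extension_objectsD[OF obj]
  interpret X: left_module R X by (rule D(2))
  show ?thesis
  proof (intro graded_action.intro graded_action_axioms.intro D(2))
    show "trivial_extension n R M \<Phi>" by unfold_locales
  next
    fix i m x assume i: "i \<in> {1..n}" and m: "m \<in> carrier (M i)" and x: "x \<in> carrier X"
    interpret T: tensor_product R "M i" X using i D(2) by (rule tensor_product_M)
    have f: "t \<in> carrier T.T \<Longrightarrow> f i t \<in> carrier X"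
      "s \<in> carrier T.T \<Longrightarrow> t \<in> carrier T.T \<Longrightarrow> f i (s \<otimes>\<^bsub>T.T\<^esub> t) = f i s \<oplus>\<^bsub>X\<^esub> f i t"
      "r \<in> carrier R \<Longrightarrow> t \<in> carrier T.T \<Longrightarrow> f i (r \<odot>\<^bsub>tensor R (M i) X\<^esub> t) = r \<odot>\<^bsub>X\<^esub> f i t" for r s t
      using D(4)[OF i] by (auto simp: left_module_hom_def)
    show "obj_act X f i m x \<in> carrier X" using m x by (simp add: f T.elt_closed)
    show "obj_act X f i (m \<oplus>\<^bsub>M i\<^esub> m') x = obj_act X f i m x \<oplus>\<^bsub>X\<^esub> obj_act X f i m' x"
      if "m' \<in> carrier (M i)" for m' using m x that by (simp add: f T.elt_closed T.elt_add_left)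
    show "obj_act X f i m (x \<oplus>\<^bsub>X\<^esub> x') = obj_act X f i m x \<oplus>\<^bsub>X\<^esub> obj_act X f i m x'"
      if "x' \<in> carrier X" for x' using m x that by (simp add: f T.elt_closed T.elt_add_right)
    show "obj_act X f i (r \<odot>\<^bsub>M i\<^esub> m) x = r \<odot>\<^bsub>X\<^esub> obj_act X f i m x"
      if "r \<in> carrier R" for r using m x that by (simp add: f T.elt_closed flip: T.smult_elt)
    show "obj_act X f i (m \<star>\<^bsub>M i\<^esub> r) x = obj_act X f i m (r \<odot>\<^bsub>X\<^esub> x)"
      if "r \<in> carrier R" for r using m x that by (simp add: T.elt_balanced)
    fix j m' assume j: "j \<in> {1..n}" and m': "m' \<in> carrier (M j)"
    interpret Tj: tensor_product R "M j" X using j D(2) by (rule tensor_product_M)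
    interpret Tij: tensor_product R "M i" "tensor R (M j) X"
      using i Tj.left_module_tensor by (rule tensor_product_M)
    have c: "Tj.elt m' x \<in> carrier (tensor R (M j) X)" using m' x by (simp add: Tj.elt_closed)
    then have "Tij.elt m (Tj.elt m' x) \<in> carrier (tensor R (M i) (tensor R (M j) X))"
      using m by (simp add: Tij.elt_closed)
    from D(6)[OF i j this]
    show "obj_act X f i m (obj_act X f j m' x) =
        (if i + j \<le> n then obj_act X f (i + j) (mul i j m m') x else \<zero>\<^bsub>X\<^esub>)"
      using F_map_elt[OF i Tj.left_module_tensor D(2) D(4)[OF j] m c]
        phi_tensor_elt[OF i j _ D(2) m m' x] by simp
  qed
qed

text \<open>The restriction to \<open>{1..n}\<close> makes the family extensional, as the second
  component of an object has to be.\<close>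

definition lift_act :: "('r, 'x) module \<Rightarrow> (nat \<Rightarrow> 'm \<Rightarrow> 'x \<Rightarrow> 'x) \<Rightarrow> nat \<Rightarrow> ('m, 'x) tens \<Rightarrow> 'x"
  where "lift_act X a = (\<lambda>i\<in>{1..n}. tensor_lift R (M i) X (add_monoid X) (a i))"

lemma lift_act:
  assumes a: "graded_action n R M \<Phi> X a" and i: "i \<in> {1..n}"
  shows lift_act_hom: "lift_act X a i \<in> left_module_hom R (tensor R (M i) X) X"
    and lift_act_extensional: "lift_act X a i \<in> extensional (carrier (tensor R (M i) X))"
    and lift_act_elt: "m \<in> carrier (M i) \<Longrightarrow> x \<in> carrier X \<Longrightarrow>
      lift_act X a i (tensor_elt R (M i) X m x) = a i m x"
proof -
  interpret graded_action n R M \<Phi> X a by (rule a)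
  interpret T: tensor_product R "M i" X using i X.left_module_axioms by (rule tensor_product_M)
  have b: "balanced R (M i) X (add_monoid X) (a i)"
    using i by (simp add: balanced_def act_closed act_add_left act_add_right act_balanced
        del: atLeastAtMost_iff)
  note lift = T.tensor_lift_left_module_hom[OF X.left_module_axioms b act_smult[OF i]]
    T.tensor_lift_extensional[OF X.M.a_comm_group b]
  show "lift_act X a i \<in> left_module_hom R (tensor R (M i) X) X"
    and "lift_act X a i \<in> extensional (carrier (tensor R (M i) X))"
    and "m \<in> carrier (M i) \<Longrightarrow> x \<in> carrier X \<Longrightarrow>
      lift_act X a i (tensor_elt R (M i) X m x) = a i m x"
    using i lift by (simp_all add: lift_act_def del: atLeastAtMost_iff)
qed

text \<open>Both sides of the compatibility condition are group homomorphisms on the iterated tensor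
  product, so \<open>iterated_hom_eqI\<close> leaves only \<open>act_act\<close> to be used.\<close>

lemma lift_act_object:
  assumes X: "X \<in> left_modules R" and a: "graded_action n R M \<Phi> X a"
  shows "(X, lift_act X a) \<in> trivial_extension_objects n R M \<Phi>"
proof -
  interpret graded_action n R M \<Phi> X a by (rule a)
  let ?f = "lift_act X a"
  have hom: "?f i \<in> hom (tensor_group R (M i) X) (add_monoid X)" if i: "i \<in> {1..n}" for i
    using tensor_product.left_module_hom_tensor_hom[OF tensor_product_M[OF i X.left_module_axioms]]
      lift_act_hom[OF a i] by blast
  have "?f i (F_map R M i (tensor R (M j) X) X (?f j) t) =
      (if i + j \<le> n then ?f (i + j) (phi_tensor R M \<Phi> i j X t) else \<zero>\<^bsub>X\<^esub>)"
    if i: "i \<in> {1..n}" and j: "j \<in> {1..n}" and t: "t \<in> carrier (tensor R (M i) (tensor R (M j) X))" for i j t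
  proof -
    interpret A: tensor_associativity R "M i" "M j" X
      using i j X.left_module_axioms by (intro tensor_associativity.intro bimodule_M)
    have tj: "left_module R (tensor R (M j) X)" by (rule A.BX.left_module_tensor)
    note F = F_map[OF i tj X.left_module_axioms lift_act_hom[OF a j]]
    show ?thesis
    proof (rule A.iterated_hom_eqI[where H = "add_monoid X"])
      show "group (add_monoid X)" by (rule X.M.a_group)
      show "t \<in> carrier A.A_BX.T" using t by simp
      show "(\<lambda>t. ?f i (F_map R M i (tensor R (M j) X) X (?f j) t)) \<in> hom A.A_BX.T (add_monoid X)"
        using hom_compose[OF F(1) hom[OF i]] by (simp add: comp_def)
      \<comment> \<open>Above degree \<open>n\<close> the right side is the constant zero map, which
        is a homomorphism too, so the same comparison covers both conditions.\<close>
      show "(\<lambda>t. if i + j \<le> n then ?f (i + j) (phi_tensor R M \<Phi> i j X t) else \<zero>\<^bsub>X\<^esub>) \<in>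
          hom A.A_BX.T (add_monoid X)"
      proof (cases "i + j \<le> n")
        case True
        then have "i + j \<in> {1..n}" using i by auto
        from hom_compose[OF phi_tensor_hom[OF i j True X.left_module_axioms] hom[OF this]] True
        show ?thesis by (simp add: comp_def)
      next
        case False
        then show ?thesis by (simp add: hom_def)
      qed
      fix m m' x assume m: "m \<in> carrier (M i)" "m' \<in> carrier (M j)" and x: "x \<in> carrier X"
      have c: "A.BX.elt m' x \<in> carrier (tensor R (M j) X)" using m x by (simp add: A.BX.elt_closed)
      have ij: "i + j \<in> {1..n}" "mul i j m m' \<in> carrier (M (i + j))" if "i + j \<le> n"
        using that i j m by (auto intro: mul_closed)
      show "?f i (F_map R M i (tensor R (M j) X) X (?f j) (A.A_BX.elt m (A.BX.elt m' x))) =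
          (if i + j \<le> n then ?f (i + j) (phi_tensor R M \<Phi> i j X (A.A_BX.elt m (A.BX.elt m' x))) else \<zero>\<^bsub>X\<^esub>)"
        using F(2)[OF m(1) c] lift_act_elt[OF a] ij i j m x act_act[OF i j m x]
          phi_tensor_elt[OF i j _ X.left_module_axioms m x] act_closed[OF j m(2) x]
        by (simp del: atLeastAtMost_iff)
    qed
  qed
  then show ?thesis
    using X lift_act_hom[OF a] lift_act_extensional[OF a]
    by (auto simp: trivial_extension_objects_def PiE_iff lift_act_def)
qed

text \<open>The two paths around the square of a morphism are group homomorphisms out of a tensor
  product, so it suffices to compare them on pure tensors.\<close>

lemma morphism_iff:
  assumes obj: "(X, f) \<in> trivial_extension_objects n R M \<Phi>" "(Y, g) \<in> trivial_extension_objects n R M \<Phi>"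
    and \<gamma>: "\<gamma> \<in> left_module_hom R X Y" and i: "i \<in> {1..n}"
  shows "(\<forall>t\<in>carrier (tensor R (M i) X). \<gamma> (f i t) = g i (F_map R M i X Y \<gamma> t)) \<longleftrightarrow>
    (\<forall>m\<in>carrier (M i). \<forall>x\<in>carrier X. \<gamma> (obj_act X f i m x) = obj_act Y g i m (\<gamma> x))"
    (is "?l \<longleftrightarrow> ?r")
proof -
  note X = trivial_extension_objectsD[OF obj(1)] and Y = trivial_extension_objectsD[OF obj(2)]
  interpret TX: tensor_product R "M i" X using i X(2) by (rule tensor_product_M)
  interpret TY: tensor_product R "M i" Y using i Y(2) by (rule tensor_product_M)
  note F = F_map[OF i X(2) Y(2) \<gamma>]
  show ?thesis
  proof
    assume ?l
    then show ?r by (simp add: TX.elt_closed F(2))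
  next
    assume r: ?r
    have "\<gamma> \<in> hom (add_monoid X) (add_monoid Y)"
      using \<gamma> by (auto simp: left_module_hom_def hom_def)
    note h = hom_compose[OF TX.left_module_hom_tensor_hom[OF X(4)[OF i]] this, unfolded comp_def]
      hom_compose[OF F(1) TY.left_module_hom_tensor_hom[OF Y(4)[OF i]], unfolded comp_def]
    have "\<gamma> (f i t) = g i (F_map R M i X Y \<gamma> t)" if "t \<in> carrier TX.T" for t
      using TX.hom_eqI[OF TY.B.M.a_group h that] r F(2) by simp
    then show ?l by simp
  qed
qed

text \<open>Uniqueness of lifts fixes each \<open>f i\<close> on its carrier, and extensionality of
  the family and of its members does the rest. Agreement of the actions is assumed on carriers only,
  because the action read back from an extension module is \<open>undefined\<close>
  elsewhere.\<close>

lemma lift_obj_act: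
  assumes obj: "(X, f) \<in> trivial_extension_objects n R M \<Phi>"
    and a: "graded_action n R M \<Phi> X a"
    and eq: "\<And>i m x. i \<in> {1..n} \<Longrightarrow> m \<in> carrier (M i) \<Longrightarrow> x \<in> carrier X \<Longrightarrow> a i m x = obj_act X f i m x"
  shows "lift_act X a = f"
proof (rule extensionalityI)
  note X = trivial_extension_objectsD[OF obj]
  show "f \<in> extensional {1..n}" by (rule X(3))
  fix i assume i: "i \<in> {1..n}"
  interpret T: tensor_product R "M i" X using i X(2) by (rule tensor_product_M)
  note L = lift_act[OF a i]
  show "lift_act X a i = f i"
  proof (rule extensionalityI[OF L(2) X(5)[OF i]])
    fix t assume "t \<in> carrier (tensor R (M i) X)"
    then show "lift_act X a i t = f i t"
      using T.hom_eqI[OF T.B.M.a_group T.left_module_hom_tensor_hom[OF L(1)]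
          T.left_module_hom_tensor_hom[OF X(4)[OF i]]]
      by (simp add: L(3) eq[OF i])
  qed
qed (simp add: lift_act_def)

lemma isomorphic_module_category:
  "isomorphic_categories
    (trivial_extension_category n R M \<Phi> ::
      (('r, 'x) module \<times> (nat \<Rightarrow> ('m, 'x) tens \<Rightarrow> 'x), 'x \<Rightarrow> 'x) category)
    (left_module_category S :: (('r \<times> (nat \<Rightarrow> 'm), 'x) module, 'x \<Rightarrow> 'x) category)"
proof (rule isomorphic_categoriesI[where
      F = "\<lambda>(X, f). extension_module X (obj_act X f)" and
      G = "\<lambda>Y. (restrict_module Y, lift_act (restrict_module Y) (emb_act Y))"])
  let ?C = "trivial_extension_category n R M \<Phi> ::
      (('r, 'x) module \<times> (nat \<Rightarrow> ('m, 'x) tens \<Rightarrow> 'x), 'x \<Rightarrow> 'x) category"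
  let ?D = "left_module_category S :: (('r \<times> (nat \<Rightarrow> 'm), 'x) module, 'x \<Rightarrow> 'x) category"
  let ?F = "\<lambda>(X, f). extension_module X (obj_act X f)"
  let ?G = "\<lambda>Y. (restrict_module Y, lift_act (restrict_module Y) (emb_act Y))"
  have C: "Obj ?C = trivial_extension_objects n R M \<Phi>" and D: "Obj ?D = left_modules S"
    by (simp_all add: trivial_extension_category_def left_module_category_def)
  show "category ?D" by (rule category_left_module_category)
  show "?F Z \<in> Obj ?D" if "Z \<in> Obj ?C" for Z
    using that extension_module_left_modules[OF trivial_extension_objectsD(1) graded_action_object]
    by (cases Z) (simp add: C D)
  show "?G Y \<in> Obj ?C" if "Y \<in> Obj ?D" for Y
    using that by (auto simp: C D intro!: lift_act_object restrict_module_left_modules graded_action_restrict)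
  show "?G (?F Z) = Z" if "Z \<in> Obj ?C" for Z
  proof -
    obtain X f where Z: "Z = (X, f)" by (cases Z)
    with that have obj: "(X, f) \<in> trivial_extension_objects n R M \<Phi>" by (simp add: C)
    note X = trivial_extension_objectsD(1)[OF obj] graded_action_object[OF obj]
    note E = restrict_extension[OF X] extension_module_left_modules[OF X]
    \<comment> \<open>Once the underlying module is identified with \<open>X\<close>, it remains to
      see that scalars \<open>emb i m\<close> act on the extension module as \<open>f i\<close> does
      on pure tensors; this is \<open>graded_smult_emb\<close>.\<close>
    have "lift_act X (emb_act (extension_module X (obj_act X f))) = f"
      using obj
    proof (rule lift_obj_act)
      show "graded_action n R M \<Phi> X (emb_act (extension_module X (obj_act X f)))"
        using graded_action_restrict[OF E(2)] by (simp add: E(1))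
    qed (simp add: emb_closed graded_action.graded_smult_emb[OF X(2)])
    then show ?thesis by (simp add: Z E(1))
  qed
  \<comment> \<open>By \<open>lift_act_elt\<close> the lifted maps return the action of
    \<open>emb\<close> on pure tensors, which is the premise of
    \<open>extension_restrict\<close>.\<close>
  show "?F (?G Y) = Y" if "Y \<in> Obj ?D" for Y
    using that lift_act_elt[OF graded_action_restrict]
    by (auto simp: D simp del: atLeastAtMost_iff intro!: extension_restrict)
  fix Z W assume "Z \<in> Obj ?C" "W \<in> Obj ?C"
  then obtain X f Y g where ZW: "Z = (X, f)" "W = (Y, g)"
    and obj: "(X, f) \<in> trivial_extension_objects n R M \<Phi>" "(Y, g) \<in> trivial_extension_objects n R M \<Phi>"
    by (cases Z, cases W) (auto simp: C)
  show "Hom ?C Z W = Hom ?D (?F Z) (?F W)"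
  proof (rule Set.set_eqI)
    fix \<gamma>
    have "\<gamma> \<in> Hom ?C Z W \<longleftrightarrow> \<gamma> \<in> left_module_hom R X Y \<and> \<gamma> \<in> extensional (carrier X) \<and>
        (\<forall>i\<in>{1..n}. \<forall>t\<in>carrier (tensor R (M i) X). \<gamma> (f i t) = g i (F_map R M i X Y \<gamma> t))"
      by (simp add: ZW trivial_extension_category_def left_module_category_def conj_assoc)
    also have "\<dots> \<longleftrightarrow> \<gamma> \<in> left_module_hom R X Y \<and> \<gamma> \<in> extensional (carrier X) \<and>
        (\<forall>i\<in>{1..n}. \<forall>m\<in>carrier (M i). \<forall>x\<in>carrier X. \<gamma> (obj_act X f i m x) = obj_act Y g i m (\<gamma> x))"
      by (intro conj_cong ball_cong refl morphism_iff[OF obj])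
    also have "\<dots> \<longleftrightarrow> \<gamma> \<in> Hom ?D (?F Z) (?F W)"
      by (simp add: ZW left_module_category_def conj_ac
          extension_hom_iff[OF graded_action_object[OF obj(1)] graded_action_object[OF obj(2)]])
    finally show "\<gamma> \<in> Hom ?C Z W \<longleftrightarrow> \<gamma> \<in> Hom ?D (?F Z) (?F W)" .
  qed
  show "Ident ?C Z = Ident ?D (?F Z)"
    by (simp add: ZW trivial_extension_category_def left_module_category_def)
  show "Comp ?C Z W V = Comp ?D (?F Z) (?F W) (?F V)" for V
    by (cases V) (simp add: ZW trivial_extension_category_def left_module_category_def)
qed

end

theorem theorem2p2:
  fixes R :: "('r, 's) ring_scheme"
    and n :: nat
    and M :: "nat \<Rightarrow> ('r, 'm) bimodule"
    and \<Phi> :: "nat \<Rightarrow> nat \<Rightarrow> ('m, 'm) tens \<Rightarrow> 'm"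
  assumes "ring R"
    and "n \<ge> 1"
    and "\<forall>i\<in>{1..n}. bimodule R (M i)"
    and "associative_products n R M \<Phi>"
  shows "isomorphic_categories
    (trivial_extension_category n R M \<Phi> ::
      (('r, 'x) module \<times> (nat \<Rightarrow> ('m, 'x) tens \<Rightarrow> 'x), 'x \<Rightarrow> 'x) category)
    (left_module_category (trivial_extension_ring n R M \<Phi>) ::
      (('r \<times> (nat \<Rightarrow> 'm), 'x) module, 'x \<Rightarrow> 'x) category)"
proof -
  interpret trivial_extension n R M \<Phi>
    using assms by (intro trivial_extension.intro) auto
  show ?thesis by (rule isomorphic_module_category)
qed

end
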